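(* Let $\mathbb{Y}=\{P_1,\dots,P_4,Q_1,Q_2,Q_3\}$ be a set of seven distinct points in $\mathbb{P}^2$ such that $P_1,\dots,P_4$ lie on a line $L$, $Q_1,Q_2,Q_3$ are not on $L$ and are not collinear, and none of $P_1,\dots,P_4$ is $\mathcal{Q}$-collinear. Let $n>7$ and let $\mathbb{X}$ be a set of $n$ distinct points obtained from $\mathbb{Y}$ by adding $n-7$ further points on $L$. Then $\hat{\alpha}_{\mathbb{X}}=\hat{\alpha}_{\mathbb{Y}}=\frac{5}{2}$.
   Context: $\mathbb{K}$ is an algebraically closed field of characteristic zero, $\mathbb{P}^2=\mathbb{P}^2_{\mathbb{K}}$. For a finite set $\mathbb{X}=\{P_1,\dots,P_n\}$, $I_{\mathbb{X}}^{(m)}=\bigcap_i I(P_i)^m$ where $I(P_i)\subset\mathbb{K}[x_0,x_1,x_2]$ is the homogeneous prime ideal of $P_i$; $\alpha(I)$ is the least degree of a nonzero homogeneous element of $I$; $\hat{\alpha}_{\mathbb{X}}=\lim_{m\to\infty}\alpha(I_{\mathbb{X}}^{(m)})/m$ is the Waldschmidt constant. For non-collinear $Q_1,Q_2,Q_3$, let $\mathcal{Q}=Q_2Q_3\cup Q_1Q_3\cup Q_1Q_2$; a point of $\mathcal{Q}\setminus\{Q_1,Q_2,Q_3\}$ is called $\mathcal{Q}$-collinear. *)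

theory Defs
  imports "HOL-Analysis.Analysis" "HOL-Library.Poly_Mapping"
    "HOL-Computational_Algebra.Polynomial"
begin

text \<open>
  \<open>'k poly3\<close> is the polynomial ring in the three variables \<open>x\<^sub>i\<close>, \<open>i :: 3\<close> (so the indices are
  \<open>0, 1, 2\<close>): finitely supported functions from exponent vectors to coefficients, with the
  convolution product of \<^theory>\<open>HOL-Library.Poly_Mapping\<close>.
\<close>

type_synonym 'k poly3 = "(3 \<Rightarrow>\<^sub>0 nat) \<Rightarrow>\<^sub>0 'k"

definition eval_poly3 :: "'k::field poly3 \<Rightarrow> 'k^3 \<Rightarrow> 'k" where
  "eval_poly3 f v =
    (\<Sum>e\<in>Poly_Mapping.keys f.
      Poly_Mapping.lookup f e * (\<Prod>i\<in>UNIV. (v $ i) ^ Poly_Mapping.lookup e i))"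

text \<open>The zero polynomial is homogeneous of every degree.\<close>

definition homogeneous_poly3 :: "nat \<Rightarrow> 'k::field poly3 \<Rightarrow> bool" where
  "homogeneous_poly3 d f \<longleftrightarrow>
    (\<forall>e\<in>Poly_Mapping.keys f. (\<Sum>i\<in>UNIV. Poly_Mapping.lookup e i) = d)"

text \<open>
  Ideals are the submodules of a ring seen as a module over itself, so the ideal generated by a
  set is its span.
\<close>

definition ideal_generated :: "'a::comm_ring_1 set \<Rightarrow> 'a set" where
  "ideal_generated S = module.span (*) S"

lemma module_times: "module ((*) :: 'a::comm_ring_1 \<Rightarrow> 'a \<Rightarrow> 'a)"
  by unfold_locales (auto simp: algebra_simps)

definition ideal_power :: "'a::comm_ring_1 set \<Rightarrow> nat \<Rightarrow> 'a set" where
  "ideal_power I m = ideal_generated {\<Prod>i<m. f i | f. \<forall>i<m. f i \<in> I}"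

text \<open>
  Points and lines of the projective plane are the linear subspaces of \<open>'k^3\<close> of dimension one
  and two. A point \<open>P\<close> lies on a line \<open>L\<close> iff \<open>P \<subseteq> L\<close>.
\<close>

definition proj_points :: "('k::field^3) set set" where
  "proj_points = {P. vec.subspace P \<and> vec.dim P = 1}"

definition proj_lines :: "('k::field^3) set set" where
  "proj_lines = {L. vec.subspace L \<and> vec.dim L = 2}"

definition line_through :: "('k::field^3) set \<Rightarrow> ('k^3) set \<Rightarrow> ('k^3) set" where
  "line_through P Q = vec.span (P \<union> Q)"

definition proj_collinear :: "('k::field^3) set set \<Rightarrow> bool" where
  "proj_collinear X \<longleftrightarrow> (\<exists>L\<in>proj_lines. \<forall>P\<in>X. P \<subseteq> L)"

definition Q_collinear ::
  "('k::field^3) set \<Rightarrow> ('k^3) set \<Rightarrow> ('k^3) set \<Rightarrow> ('k^3) set \<Rightarrow> bool" where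
  "Q_collinear Q1 Q2 Q3 P \<longleftrightarrow>
    P \<in> proj_points \<and>
    (P \<subseteq> line_through Q2 Q3 \<or> P \<subseteq> line_through Q1 Q3 \<or> P \<subseteq> line_through Q1 Q2) \<and>
    P \<notin> {Q1, Q2, Q3}"

definition point_ideal :: "('k::field^3) set \<Rightarrow> 'k poly3 set" where
  "point_ideal P =
    ideal_generated {f. (\<exists>d. homogeneous_poly3 d f) \<and> (\<forall>v\<in>P. eval_poly3 f v = 0)}"

definition symbolic_power :: "('k::field^3) set set \<Rightarrow> nat \<Rightarrow> 'k poly3 set" where
  "symbolic_power X m = (\<Inter>P\<in>X. ideal_power (point_ideal P) m)"

definition initial_degree :: "'k::field poly3 set \<Rightarrow> nat" where
  "initial_degree I = (LEAST d. \<exists>f\<in>I. f \<noteq> 0 \<and> homogeneous_poly3 d f)"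

definition waldschmidt :: "('k::field^3) set set \<Rightarrow> real" where
  "waldschmidt X = lim (\<lambda>m. real (initial_degree (symbolic_power X m)) / real m)"

end

theory Submission
  imports Defs
begin

text \<open>
  The line \<open>L\<close> together with the three lines \<open>Q\<^sub>iQ\<^sub>j\<close>, taken with weights \<open>2, 1, 1, 1\<close>, is a quintic
  with multiplicity \<open>2\<close> everywhere on \<open>L\<close> and at the \<open>Q\<^sub>i\<close>; this gives the upper bound \<open>5/2\<close>.
  For the lower bound, the quartics through \<open>P\<^sub>1, \<dots>, P\<^sub>4\<close> that are double at \<open>Q\<^sub>1, Q\<^sub>2, Q\<^sub>3\<close> contain a pencil
  of rational curves, the images under the quadratic Cremona transformation based at the \<open>Q\<^sub>i\<close> of the
  conics through the four transformed points \<open>P\<^sub>i\<close>. Restricting a form \<open>f\<close> of degree \<open>D\<close> with multiplicity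
  \<open>m\<close> at the seven points to a parametrised member of the pencil gives a polynomial of degree at
  most \<open>4D\<close>, divisible by a polynomial of degree \<open>10m\<close>. It is nonzero for a generic member,
  since the pencil sweeps out the plane; hence \<open>10m \<le> 4D\<close>.
\<close>

section \<open>Substitution into ternary forms\<close>

text \<open>For fixed \<open>\<phi>\<close> this is the ring homomorphism that restricts a form to
  the curve parametrised by \<open>\<phi>\<close>. Constant \<open>\<phi>\<close> recover evaluation
  at a point.\<close>

definition subst_poly3 :: "(3 \<Rightarrow> 'k poly) \<Rightarrow> 'k::field poly3 \<Rightarrow> 'k poly" where
  "subst_poly3 \<phi> f =
    (\<Sum>e\<in>Poly_Mapping.keys f.
      smult (Poly_Mapping.lookup f e) (\<Prod>i\<in>UNIV. \<phi> i ^ Poly_Mapping.lookup e i))"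

lemma subst_poly3_supset:
  assumes "finite A" "Poly_Mapping.keys f \<subseteq> A"
  shows "subst_poly3 \<phi> f =
    (\<Sum>e\<in>A. smult (Poly_Mapping.lookup f e) (\<Prod>i\<in>UNIV. \<phi> i ^ Poly_Mapping.lookup e i))"
  unfolding subst_poly3_def
  by (rule sum.mono_neutral_left[OF assms]) (auto simp: in_keys_iff)

lemma subst_poly3_0 [simp]: "subst_poly3 \<phi> 0 = 0"
  by (simp add: subst_poly3_def)

lemma subst_poly3_add: "subst_poly3 \<phi> (f + g) = subst_poly3 \<phi> f + subst_poly3 \<phi> g"
proof -
  let ?A = "Poly_Mapping.keys f \<union> Poly_Mapping.keys g"
  have "Poly_Mapping.keys (f + g) \<subseteq> ?A" by (rule Poly_Mapping.keys_add)
  then show ?thesis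
    by (simp add: subst_poly3_supset[of ?A] lookup_add smult_add_left sum.distrib)
qed

lemma subst_poly3_sum: "subst_poly3 \<phi> (sum g A) = (\<Sum>a\<in>A. subst_poly3 \<phi> (g a))"
  by (induction A rule: infinite_finite_induct) (auto simp: subst_poly3_add)

lemma subst_poly3_single:
  "subst_poly3 \<phi> (Poly_Mapping.single e c) = smult c (\<Prod>i\<in>UNIV. \<phi> i ^ Poly_Mapping.lookup e i)"
  by (subst subst_poly3_supset[of "{e}"]) auto

lemma poly_mapping_eq_sum_single:
  "f = (\<Sum>e\<in>Poly_Mapping.keys f. Poly_Mapping.single e (Poly_Mapping.lookup f e))"
proof (rule poly_mapping_eqI)
  fix k
  show "Poly_Mapping.lookup f k =
    Poly_Mapping.lookup (\<Sum>e\<in>Poly_Mapping.keys f. Poly_Mapping.single e (Poly_Mapping.lookup f e)) k"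
    by (simp add: lookup_sum lookup_single when_def in_keys_iff)
qed

lemma subst_poly3_mult: "subst_poly3 \<phi> (f * g) = subst_poly3 \<phi> f * subst_poly3 \<phi> g"
proof -
  have "f * g = (\<Sum>d\<in>Poly_Mapping.keys f. \<Sum>e\<in>Poly_Mapping.keys g.
      Poly_Mapping.single (d + e) (Poly_Mapping.lookup f d * Poly_Mapping.lookup g e))"
    by (subst (1) poly_mapping_eq_sum_single[of f], subst (1) poly_mapping_eq_sum_single[of g])
       (simp add: sum_product mult_single)
  then have "subst_poly3 \<phi> (f * g) = (\<Sum>d\<in>Poly_Mapping.keys f. \<Sum>e\<in>Poly_Mapping.keys g.
      smult (Poly_Mapping.lookup f d * Poly_Mapping.lookup g e)
        (\<Prod>i\<in>UNIV. \<phi> i ^ Poly_Mapping.lookup (d + e) i))"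
    by (simp add: subst_poly3_sum subst_poly3_single)
  also have "\<dots> = subst_poly3 \<phi> f * subst_poly3 \<phi> g"
    by (simp add: subst_poly3_def sum_product lookup_add power_add prod.distrib mult_ac)
  finally show ?thesis .
qed

lemma subst_poly3_1 [simp]: "subst_poly3 \<phi> 1 = 1"
  using subst_poly3_single[of \<phi> 0 1] by simp

lemma subst_poly3_prod: "subst_poly3 \<phi> (prod g A) = (\<Prod>a\<in>A. subst_poly3 \<phi> (g a))"
  by (induction A rule: infinite_finite_induct) (auto simp: subst_poly3_mult)

lemma poly_subst_poly3:
  "poly (subst_poly3 \<phi> f) s = eval_poly3 f (\<chi> i. poly (\<phi> i) s)"
  by (simp add: subst_poly3_def eval_poly3_def poly_sum poly_prod)

lemma subst_poly3_scale:
  assumes "homogeneous_poly3 d f"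
  shows "subst_poly3 (\<lambda>i. c * \<phi> i) f = c ^ d * subst_poly3 \<phi> f"
  unfolding subst_poly3_def sum_distrib_left
proof (rule sum.cong[OF refl])
  fix e assume "e \<in> Poly_Mapping.keys f"
  then have "(\<Sum>i\<in>UNIV. Poly_Mapping.lookup e i) = d"
    using assms by (auto simp: homogeneous_poly3_def)
  then show "smult (Poly_Mapping.lookup f e) (\<Prod>i\<in>UNIV. (c * \<phi> i) ^ Poly_Mapping.lookup e i) =
    c ^ d * smult (Poly_Mapping.lookup f e) (\<Prod>i\<in>UNIV. \<phi> i ^ Poly_Mapping.lookup e i)"
    by (simp add: power_mult_distrib prod.distrib flip: power_sum)
qed

lemma eval_poly3_scale:
  assumes "homogeneous_poly3 d f"
  shows "eval_poly3 f (c *s v) = c ^ d * eval_poly3 f v"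
  unfolding eval_poly3_def sum_distrib_left
proof (rule sum.cong[OF refl])
  fix e assume "e \<in> Poly_Mapping.keys f"
  then have "(\<Sum>i\<in>UNIV. Poly_Mapping.lookup e i) = d"
    using assms by (auto simp: homogeneous_poly3_def)
  then show "Poly_Mapping.lookup f e * (\<Prod>i\<in>UNIV. ((c *s v) $ i) ^ Poly_Mapping.lookup e i) =
    c ^ d * (Poly_Mapping.lookup f e * (\<Prod>i\<in>UNIV. (v $ i) ^ Poly_Mapping.lookup e i))"
    by (simp add: power_mult_distrib prod.distrib flip: power_sum)
qed

lemma subst_poly3_const: "subst_poly3 (\<lambda>i. [:v $ i:]) f = [:eval_poly3 f v:]"
proof -
  have 0: "(\<Prod>i\<in>A. [:g i:]) = [:\<Prod>i\<in>A. g i:]" for A :: "3 set" and g :: "3 \<Rightarrow> 'a"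
    by (induction A rule: infinite_finite_induct) (auto simp: one_pCons)
  have 1: "(\<Prod>i\<in>UNIV. [:v $ i:] ^ Poly_Mapping.lookup e i) =
      [:\<Prod>i\<in>UNIV. (v $ i) ^ Poly_Mapping.lookup e i:]" for e :: "3 \<Rightarrow>\<^sub>0 nat"
    by (simp add: poly_const_pow 0)
  show ?thesis
    unfolding subst_poly3_def eval_poly3_def 1 by (simp add: sum_to_poly)
qed

lemma degree_subst_poly3_le:
  assumes "homogeneous_poly3 d f" "\<And>i. degree (\<phi> i) \<le> D"
  shows "degree (subst_poly3 \<phi> f) \<le> D * d"
  unfolding subst_poly3_def
proof (rule degree_sum_le)
  fix e assume e: "e \<in> Poly_Mapping.keys f"
  have "degree (\<Prod>i\<in>UNIV. \<phi> i ^ Poly_Mapping.lookup e i)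
      \<le> (\<Sum>i\<in>UNIV. degree (\<phi> i ^ Poly_Mapping.lookup e i))"
    using degree_prod_sum_le[of UNIV "\<lambda>i. \<phi> i ^ Poly_Mapping.lookup e i"] by (simp add: comp_def)
  also have "\<dots> \<le> (\<Sum>i\<in>UNIV. D * Poly_Mapping.lookup e i)"
    by (intro sum_mono) (metis assms(2) degree_power_le le_trans mult_le_mono1)
  also have "\<dots> = D * d"
    using assms(1) e by (simp add: homogeneous_poly3_def flip: sum_distrib_left)
  finally show "degree (smult (Poly_Mapping.lookup f e) (\<Prod>i\<in>UNIV. \<phi> i ^ Poly_Mapping.lookup e i)) \<le> D * d"
    using degree_smult_le le_trans by blast
qed simp

section \<open>Vanishing order of an ideal power along a curve\<close>

lemma dvd_diff_prod:
  fixes a b :: "'i \<Rightarrow> 'a::comm_ring_1"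
  assumes "\<And>i. i \<in> A \<Longrightarrow> g dvd a i - b i"
  shows "g dvd prod a A - prod b A"
  using assms
proof (induction A rule: infinite_finite_induct)
  case (insert x F)
  have "a x * prod a F - b x * prod b F = (a x - b x) * prod a F + b x * (prod a F - prod b F)"
    by (simp add: algebra_simps)
  then show ?case using insert by simp
qed auto

lemma dvd_diff_power:
  fixes a b :: "'a::comm_ring_1"
  assumes "g dvd a - b"
  shows "g dvd a ^ n - b ^ n"
  using dvd_diff_prod[of "{..<n}" g "\<lambda>_. a" "\<lambda>_. b"] assms by simp

lemma subst_poly3_cong_mod:
  assumes "\<And>i. g dvd \<phi> i - \<psi> i"
  shows "g dvd subst_poly3 \<phi> f - subst_poly3 \<psi> f"
  unfolding subst_poly3_def sum_subtractf[symmetric] smult_diff_right[symmetric]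
  by (intro dvd_sum dvd_smult dvd_diff_prod dvd_diff_power assms)

text \<open>Modulo \<open>g\<close> the curve is the single vector \<open>q\<close> scaled by the
  polynomial \<open>c\<close>. A homogeneous generator of degree d therefore becomes c^d times its
  value at \<open>q\<close>, which is 0, and multiples and sums stay divisible by
  \<open>g\<close>.\<close>

lemma dvd_subst_poly3_point_ideal:
  assumes "q \<in> P" "\<And>i. g dvd \<phi> i - c * [:q $ i:]" "f \<in> point_ideal P"
  shows "g dvd subst_poly3 \<phi> f"
proof -
  have "f \<in> module.span (*) {f. (\<exists>d. homogeneous_poly3 d f) \<and> (\<forall>v\<in>P. eval_poly3 f v = 0)}"
    using assms(3) by (simp add: point_ideal_def ideal_generated_def)
  then show ?thesis
  proof (induction rule: module.span_induct_alt[OF module_times, consumes 1])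
    case (2 r h y)
    then obtain d where d: "homogeneous_poly3 d h" and 0: "eval_poly3 h q = 0"
      using assms(1) by blast
    have "g dvd subst_poly3 \<phi> h - subst_poly3 (\<lambda>i. c * [:q $ i:]) h"
      by (rule subst_poly3_cong_mod) (rule assms(2))
    then have "g dvd subst_poly3 \<phi> h"
      by (simp only: subst_poly3_scale[OF d] subst_poly3_const 0) simp
    then show ?case
      using 2 by (simp add: subst_poly3_add subst_poly3_mult)
  qed simp
qed

lemma power_dvd_subst_poly3_ideal_power:
  assumes "q \<in> P" "\<And>i. g dvd \<phi> i - c * [:q $ i:]" "f \<in> ideal_power (point_ideal P) m"
  shows "g ^ m dvd subst_poly3 \<phi> f"
proof -
  have "f \<in> module.span (*) {\<Prod>i<m. f i | f. \<forall>i<m. f i \<in> point_ideal P}"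
    using assms(3) by (simp add: ideal_power_def ideal_generated_def)
  then show ?thesis
  proof (induction rule: module.span_induct_alt[OF module_times, consumes 1])
    case (2 r h y)
    then obtain hs where hs: "h = (\<Prod>i<m. hs i)" "\<forall>i<m. hs i \<in> point_ideal P" by blast
    have "(\<Prod>i<m. g) dvd (\<Prod>i<m. subst_poly3 \<phi> (hs i))"
      by (intro prod_dvd_prod dvd_subst_poly3_point_ideal[OF assms(1,2)]) (use hs in auto)
    then have "g ^ m dvd subst_poly3 \<phi> h" by (simp add: hs(1) subst_poly3_prod)
    then show ?case
      using 2 by (simp add: subst_poly3_add subst_poly3_mult)
  qed simp
qed

text \<open>Kronecker's substitution: a large base \<open>N\<close> makes the exponents of distinct monomials distinct.\<close>

lemma eval_poly3_nonzero:
  fixes f :: "'k::field_char_0 poly3"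
  assumes "f \<noteq> 0"
  obtains v where "eval_poly3 f v \<noteq> 0"
proof -
  let ?l = "Poly_Mapping.lookup"
  obtain N where N: "\<And>e i. e \<in> Poly_Mapping.keys f \<Longrightarrow> ?l e i < N"
  proof -
    have "finite (\<Union>e\<in>Poly_Mapping.keys f. range (?l e))" by auto
    then obtain N where "\<forall>x\<in>(\<Union>e\<in>Poly_Mapping.keys f. range (?l e)). x < N"
      using finite_nat_set_iff_bounded by auto
    then show ?thesis using that by blast
  qed
  define code where "code e = ?l e 1 + N * (?l e 2 + N * ?l e 3)" for e :: "3 \<Rightarrow>\<^sub>0 nat"
  have inj: "inj_on code (Poly_Mapping.keys f)"
  proof (rule inj_onI)
    fix e e' assume e: "e \<in> Poly_Mapping.keys f" "e' \<in> Poly_Mapping.keys f" "code e = code e'"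
    note b = N[OF e(1)] N[OF e(2)]
    have step: "x = x' \<and> y = y'" if "x + N * y = x' + N * y'" "x < N" "x' < N" for x x' y y'
    proof -
      have "x = x'" using that by (metis mod_less mod_mult_self2)
      then show ?thesis using that by simp
    qed
    from step[OF e(3)[unfolded code_def] b]
    have 1: "?l e 1 = ?l e' 1" and "?l e 2 + N * ?l e 3 = ?l e' 2 + N * ?l e' 3" by auto
    from step[OF this(2) b] 1 have "\<forall>i. ?l e i = ?l e' i" by (simp add: forall_3)
    then show "e = e'" by (simp add: poly_mapping_eqI)
  qed
  define \<phi> :: "3 \<Rightarrow> 'k poly" where
    "\<phi> i = monom 1 (if i = 1 then 1 else if i = 2 then N else N * N)" for i
  have U: "prod g (UNIV :: 3 set) = g 1 * g 2 * g 3" for g :: "3 \<Rightarrow> 'k poly"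
    unfolding UNIV_3 by (simp add: ac_simps)
  have "(\<Prod>i\<in>UNIV. \<phi> i ^ ?l e i) = monom 1 (code e)" for e
    by (simp add: U \<phi>_def monom_power mult_monom code_def algebra_simps)
  then have S: "subst_poly3 \<phi> f = (\<Sum>e\<in>Poly_Mapping.keys f. monom (?l f e) (code e))"
    by (simp add: subst_poly3_def smult_monom)
  obtain e0 where e0: "e0 \<in> Poly_Mapping.keys f"
    using assms by (metis all_not_in_conv keys_eq_empty)
  have "coeff (subst_poly3 \<phi> f) (code e0) =
      (\<Sum>e\<in>Poly_Mapping.keys f. if e = e0 then ?l f e else 0)"
    unfolding S coeff_sum using e0 inj by (intro sum.cong) (auto dest: inj_onD)
  also have "\<dots> \<noteq> 0" using e0 by (simp add: in_keys_iff)
  finally have "subst_poly3 \<phi> f \<noteq> 0" by auto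
  then obtain t where "poly (subst_poly3 \<phi> f) t \<noteq> 0"
    using poly_all_0_iff_0 by blast
  then show ?thesis using that by (simp add: poly_subst_poly3)
qed

text \<open>Weaker than being a polynomial function, but enough for generic choices.\<close>

definition line_poly :: "('k::field^'n \<Rightarrow> 'k) \<Rightarrow> bool" where
  "line_poly f \<longleftrightarrow> (\<forall>a b. \<exists>p. \<forall>t. f (a + t *s b) = poly p t)"

lemma line_poly_const: "line_poly (\<lambda>_. c)"
  unfolding line_poly_def by (auto intro!: exI[of _ "[:c:]"])

lemma line_poly_component: "line_poly (\<lambda>v. v $ i)"
  unfolding line_poly_def
proof (intro allI)
  fix a b :: "'a^'b"
  show "\<exists>p. \<forall>t. (a + t *s b) $ i = poly p t" by (rule exI[of _ "[:a $ i, b $ i:]"]) simp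
qed

lemma line_poly_mult: "line_poly f \<Longrightarrow> line_poly g \<Longrightarrow> line_poly (\<lambda>v. f v * g v)"
  unfolding line_poly_def by (metis poly_mult)

lemma line_poly_add: "line_poly f \<Longrightarrow> line_poly g \<Longrightarrow> line_poly (\<lambda>v. f v + g v)"
  unfolding line_poly_def by (metis poly_add)

lemma line_poly_diff: "line_poly f \<Longrightarrow> line_poly g \<Longrightarrow> line_poly (\<lambda>v. f v - g v)"
  unfolding line_poly_def by (metis poly_diff)

text \<open>Along a line the coordinates of \<open>h\<close> are univariate polynomials, and
  substituting them into \<open>f\<close> gives the required polynomial.\<close>

lemma line_poly_eval_poly3:
  assumes "\<And>i. line_poly (\<lambda>v. h v $ i)"
  shows "line_poly (\<lambda>v. eval_poly3 f (h v))"
  unfolding line_poly_def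
proof (intro allI)
  fix a b
  have "\<forall>i. \<exists>p. \<forall>t. h (a + t *s b) $ i = poly p t"
    using assms unfolding line_poly_def by blast
  then obtain p where p: "\<And>i t. h (a + t *s b) $ i = poly (p i) t" by metis
  have "h (a + t *s b) = (\<chi> i. poly (p i) t)" for t by (simp add: vec_eq_iff p)
  then show "\<exists>p. \<forall>t. eval_poly3 f (h (a + t *s b)) = poly p t"
    by (intro exI[of _ "subst_poly3 p f"]) (simp add: poly_subst_poly3)
qed

lemmas line_poly_intros = line_poly_const line_poly_component line_poly_mult line_poly_add
  line_poly_diff line_poly_eval_poly3

text \<open>On the line joining \<open>a\<close> and \<open>b\<close>, the first function is nonzero
  at parameter 0 and the second at parameter 1. Two nonzero polynomials over an infinite field have
  a common non-root.\<close>

lemma line_poly_mult_nonzero: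
  fixes f g :: "'k::field_char_0^'n \<Rightarrow> 'k"
  assumes "line_poly f" "line_poly g" "f a \<noteq> 0" "g b \<noteq> 0"
  obtains v where "f v * g v \<noteq> 0"
proof -
  obtain p where p: "\<And>t. f (a + t *s (b - a)) = poly p t"
    using assms(1) unfolding line_poly_def by metis
  obtain q where q: "\<And>t. g (a + t *s (b - a)) = poly q t"
    using assms(2) unfolding line_poly_def by metis
  have "p \<noteq> 0" using p[of 0] assms(3) by auto
  moreover have "q \<noteq> 0" using q[of 1] assms(4) by auto
  ultimately obtain t where "poly (p * q) t \<noteq> 0"
    by (metis mult_eq_0_iff poly_all_0_iff_0)
  then have "f (a + t *s (b - a)) * g (a + t *s (b - a)) \<noteq> 0" by (simp only: p q poly_mult not_False_eq_True)
  then show ?thesis by (rule that)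
qed

section \<open>Comaximal polynomials\<close>

text \<open>The Bezout identity itself is the definition, because every later argument multiplies or
  rewrites it.\<close>

definition comaximal :: "'a::comm_ring_1 \<Rightarrow> 'a \<Rightarrow> bool" where
  "comaximal p q \<longleftrightarrow> (\<exists>u v. u * p + v * q = 1)"

lemma comaximal_sym: "comaximal p q \<Longrightarrow> comaximal q p"
  unfolding comaximal_def by (metis add.commute)

lemma comaximal_1 [simp]: "comaximal p 1"
  unfolding comaximal_def by (rule exI[of _ 0], rule exI[of _ 1]) simp

text \<open>Multiply the two Bezout identities: every term other than v v' q r contains p.\<close>

lemma comaximal_mult:
  assumes "comaximal p q" "comaximal p r"
  shows "comaximal p (q * r)"
proof -
  obtain u v where 1: "u * p + v * q = 1" using assms(1) by (auto simp: comaximal_def)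
  obtain u' v' where 2: "u' * p + v' * r = 1" using assms(2) by (auto simp: comaximal_def)
  have "(u * p + v * q) * (u' * p + v' * r) = 1" by (simp only: 1 2 mult_1_right)
  then have "(u * (u' * p + v' * r) + v * q * u') * p + (v * v') * (q * r) = 1"
    by (simp add: algebra_simps)
  then show ?thesis unfolding comaximal_def by blast
qed

lemma comaximal_power: "comaximal p q \<Longrightarrow> comaximal p (q ^ n)"
  by (induction n) (auto intro: comaximal_mult)

lemma comaximal_prod_list: "(\<And>q. q \<in> set qs \<Longrightarrow> comaximal p q) \<Longrightarrow> comaximal p (prod_list qs)"
  by (induction qs) (auto intro: comaximal_mult)

text \<open>Multiply the Bezout identity by \<open>r\<close>: in one summand \<open>q\<close>
  divides \<open>r\<close>, in the other \<open>p\<close> does.\<close>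

lemma comaximal_mult_dvd:
  assumes "comaximal p q" "p dvd r" "q dvd r"
  shows "p * q dvd r"
proof -
  obtain u v where uv: "u * p + v * q = 1" using assms(1) by (auto simp: comaximal_def)
  have "r = (u * p + v * q) * r" by (simp add: uv)
  also have "\<dots> = u * (p * r) + v * (r * q)" by (simp add: algebra_simps)
  also have "p * q dvd \<dots>"
    using assms(2,3) by (intro dvd_add dvd_mult mult_dvd_mono) auto
  finally show ?thesis .
qed

lemma prod_list_power_dvd:
  assumes "sorted_wrt comaximal gs" "\<And>g. g \<in> set gs \<Longrightarrow> g ^ m dvd r"
  shows "prod_list gs ^ m dvd r"
  using assms
proof (induction gs)
  case (Cons g gs)
  have "comaximal g (prod_list gs)"
    using Cons.prems(1) by (intro comaximal_prod_list) auto
  then have "comaximal (g ^ m) (prod_list gs ^ m)"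
    by (meson comaximal_power comaximal_sym)
  then show ?case
    using Cons by (auto simp: power_mult_distrib intro: comaximal_mult_dvd)
qed simp

text \<open>The remainder of \<open>p\<close> modulo the linear polynomial is the constant
  \<open>poly p r\<close>, a unit.\<close>

lemma comaximal_linear:
  fixes p :: "'k::field poly"
  assumes "poly p r \<noteq> 0"
  shows "comaximal p [:-r, 1:]"
proof -
  have "[:-r, 1:] dvd p - [:poly p r:]"
    by (simp add: poly_eq_0_iff_dvd[symmetric])
  then obtain k where k: "p - [:poly p r:] = [:-r, 1:] * k" by (auto simp: dvd_def)
  have ring: "u * p + (- u * k) * l = u * (p - l * k)" for u l :: "'k poly"
    by (simp add: algebra_simps)
  have "[:inverse (poly p r):] * p + (- [:inverse (poly p r):] * k) * [:-r, 1:] =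
    [:inverse (poly p r):] * (p - [:-r, 1:] * k)"
    by (rule ring)
  also have "p - [:-r, 1:] * k = [:poly p r:]" by (simp only: k[symmetric]) simp
  also have "[:inverse (poly p r):] * [:poly p r:] = 1"
    using assms by (simp add: one_pCons)
  finally show ?thesis unfolding comaximal_def by blast
qed

lemma comaximal_linear_linear:
  fixes r t :: "'k::field"
  assumes "r \<noteq> t"
  shows "comaximal [:-r, 1:] [:-t, 1:]"
  by (rule comaximal_linear) (use assms in simp)

text \<open>One step of the Euclidean algorithm.\<close>

lemma comaximal_add_iff: "comaximal p (q + p * r) \<longleftrightarrow> comaximal p q"
proof
  assume "comaximal p q"
  then obtain u v where uv: "u * p + v * q = 1" by (auto simp: comaximal_def)
  have "(u - v * r) * p + v * (q + p * r) = 1" using uv by (simp add: algebra_simps)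
  then show "comaximal p (q + p * r)" unfolding comaximal_def by blast
next
  assume "comaximal p (q + p * r)"
  then obtain u v where uv: "u * p + v * (q + p * r) = 1" by (auto simp: comaximal_def)
  have "(u + v * r) * p + v * q = 1" using uv by (simp add: algebra_simps)
  then show "comaximal p q" unfolding comaximal_def by blast
qed

lemma comaximal_const:
  fixes p :: "'k::field poly"
  assumes "k \<noteq> 0"
  shows "comaximal p [:k:]"
  unfolding comaximal_def
  by (rule exI[of _ 0], rule exI[of _ "[:inverse k:]"]) (use assms in \<open>simp add: one_pCons\<close>)

section \<open>The pencil of rational quartics\<close>

text \<open>
  Coordinates are chosen such that \<open>P\<^sub>1 = q\<^sub>1 + q\<^sub>2 + q\<^sub>3\<close> and the other points of \<open>L\<close> are
  \<open>(t - a) q\<^sub>1 + (t - b) q\<^sub>2 + (t - c) q\<^sub>3\<close>, with \<open>t = 0, d, e\<close> for \<open>P\<^sub>2, P\<^sub>3, P\<^sub>4\<close>. The Cremona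
  transformation maps \<open>L\<close> to a conic, which is \<open>t \<mapsto> (1 : t : t\<^sup>2)\<close> in coordinates \<open>(X : Y : Z)\<close> such that the
  original coordinate functions become \<open>Z - (b + c) Y + b c X\<close> and its analogues. A conic of the pencil
  \<open>\<mu> (X Z - Y\<^sup>2) = Y (Z - (d + e) Y + d e X)\<close> is parametrised by the slope \<open>s = Y / X\<close> of the lines
  through its point \<open>(0 : 0 : 1)\<close>, the image of \<open>P\<^sub>1\<close>: there \<open>X = \<mu> - s\<close> and
  \<open>Z = \<mu> s\<^sup>2 - s ((d + e) s - d e)\<close>. The polynomial below is \<open>Z - (b + c) Y + b c X\<close> on this conic.
\<close>

definition conic_coord :: "'k::field \<Rightarrow> 'k \<Rightarrow> 'k \<Rightarrow> 'k \<Rightarrow> 'k \<Rightarrow> 'k poly" where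
  "conic_coord d e \<mu> b c =
    [:\<mu>:] * ([:-b, 1:] * [:-c, 1:]) - [:0, 1:] * [:b * c - d * e, d + e - b - c:]"

lemma poly_conic_coord:
  "poly (conic_coord d e \<mu> b c) s =
    \<mu> * ((s - b) * (s - c)) - s * (b * c - d * e + s * (d + e - b - c))"
  by (simp add: conic_coord_def algebra_simps)

lemma conic_coord_eq:
  "conic_coord d e \<mu> b c = [:\<mu> * b * c, - \<mu> * (b + c) - (b * c - d * e), \<mu> - (d + e - b - c):]"
  by (simp add: conic_coord_def algebra_simps)

lemma degree_conic_coord:
  assumes "\<mu> \<noteq> d + e - b - c"
  shows "degree (conic_coord d e \<mu> b c) = 2"
  using assms by (simp add: conic_coord_eq)

lemma conic_coord_commute: "conic_coord d e \<mu> b c = conic_coord d e \<mu> c b"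
  by (simp add: conic_coord_eq algebra_simps)

text \<open>0, d, e, \<mu> are the parameters at which the curve passes through P2, P3, P4, P1. At
  each of them the value splits into factors that the hypotheses make nonzero.\<close>

lemma poly_conic_coord_nonzero:
  assumes "\<mu> \<notin> {0, d, e}" "b \<notin> {0, d, e}" "c \<notin> {0, d, e}" "t \<in> {0, d, e, \<mu>}"
  shows "poly (conic_coord d e \<mu> b c) t \<noteq> 0"
proof -
  have "poly (conic_coord d e \<mu> b c) 0 = \<mu> * b * c"
    "poly (conic_coord d e \<mu> b c) d = (\<mu> - d) * (d - b) * (d - c)"
    "poly (conic_coord d e \<mu> b c) e = (\<mu> - e) * (e - b) * (e - c)"
    "poly (conic_coord d e \<mu> b c) \<mu> = \<mu> * (\<mu> - d) * (\<mu> - e)"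
    by (simp_all add: poly_conic_coord algebra_simps)
  then show ?thesis using assms by auto
qed

text \<open>The difference of the two quadratics is (a - b)(t - c)(t - \<mu>), so a common root
  could only be c or \<mu>, and the first quadratic vanishes at neither.\<close>

lemma comaximal_conic_coord:
  assumes "\<mu> \<notin> {0, d, e}" "a \<notin> {0, d, e}" "b \<notin> {0, d, e}" "c \<notin> {0, d, e}" "a \<noteq> b"
  shows "comaximal (conic_coord d e \<mu> b c) (conic_coord d e \<mu> a c)"
proof -
  let ?x = "conic_coord d e \<mu> b c"
  have "poly ?x c = c * ((c - d) * (c - e))"
    by (simp add: poly_conic_coord algebra_simps)
  then have "comaximal ?x [:-c, 1:]"
    using assms by (intro comaximal_linear) auto
  moreover have "comaximal ?x [:-\<mu>, 1:]"
    using assms by (intro comaximal_linear poly_conic_coord_nonzero) auto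
  moreover have "comaximal ?x [:a - b:]"
    using assms by (intro comaximal_const) auto
  ultimately have "comaximal ?x ([:a - b:] * ([:-c, 1:] * [:-\<mu>, 1:]))"
    by (intro comaximal_mult)
  also have "[:a - b:] * ([:-c, 1:] * [:-\<mu>, 1:]) = conic_coord d e \<mu> a c + ?x * - 1"
    by (simp add: conic_coord_eq algebra_simps)
  finally show ?thesis by (simp only: comaximal_add_iff)
qed

text \<open>The standard Cremona map (x : y : z) -> (yz : xz : xy) in the frame q1, q2, q3, applied
  to a parametrised conic; quadratic x, y, z give a quartic.\<close>

definition quartic_curve ::
  "'k::field^3 \<Rightarrow> 'k^3 \<Rightarrow> 'k^3 \<Rightarrow> 'k poly \<Rightarrow> 'k poly \<Rightarrow> 'k poly \<Rightarrow> 3 \<Rightarrow> 'k poly" where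
  "quartic_curve q1 q2 q3 x y z i =
    y * z * [:q1 $ i:] + x * z * [:q2 $ i:] + x * y * [:q3 $ i:]"

lemma linear_dvd_diff_const:
  fixes p :: "'k::field poly"
  assumes "poly p t = k"
  shows "[:-t, 1:] dvd p - [:k:]"
  using assms by (simp add: poly_eq_0_iff_dvd[symmetric])

text \<open>The curve meets each Qi at the two roots of x, y or z and each Pi at one parameter, so 3
  * 2 + 4 = 10 factors, each to the power m, divide a nonzero polynomial of degree at most 4 D.
  Excluding 0, d, e for \<mu> keeps the parameters and the quadratics apart; the other three
  exclusions keep the quadratics of degree 2.\<close>

lemma multiplicity_bound:
  fixes f :: "'k::field poly3" and q1 q2 q3 :: "'k^3"
  assumes distinct: "distinct [0, d, e]" "a \<notin> {0, d, e}" "b \<notin> {0, d, e}" "c \<notin> {0, d, e}"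
      "distinct [a, b, c]"
    and \<mu>: "\<mu> \<notin> {0, d, e, d + e - b - c, d + e - a - c, d + e - a - b}"
    and Q: "q1 \<in> Q1" "q2 \<in> Q2" "q3 \<in> Q3"
    and P: "q1 + q2 + q3 \<in> P1" "a *s q1 + b *s q2 + c *s q3 \<in> P2"
      "(d - a) *s q1 + (d - b) *s q2 + (d - c) *s q3 \<in> P3"
      "(e - a) *s q1 + (e - b) *s q2 + (e - c) *s q3 \<in> P4"
    and f: "f \<in> symbolic_power {P1, P2, P3, P4, Q1, Q2, Q3} m" "homogeneous_poly3 D f"
    and nonzero: "subst_poly3 (quartic_curve q1 q2 q3 (conic_coord d e \<mu> b c)
      (conic_coord d e \<mu> a c) (conic_coord d e \<mu> a b)) f \<noteq> 0"
  shows "10 * m \<le> 4 * D"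
proof -
  define x where "x = conic_coord d e \<mu> b c"
  define y where "y = conic_coord d e \<mu> a c"
  define z where "z = conic_coord d e \<mu> a b"
  define \<phi> where "\<phi> = quartic_curve q1 q2 q3 x y z"
  let ?F = "subst_poly3 \<phi> f"
  have F: "?F \<noteq> 0" using nonzero by (simp add: \<phi>_def x_def y_def z_def)
  have deg: "degree x = 2" "degree y = 2" "degree z = 2"
    using \<mu> by (auto simp: x_def y_def z_def intro!: degree_conic_coord)
  have xy: "comaximal x y" and xz: "comaximal x z" and yz: "comaximal y z"
    using comaximal_conic_coord[of \<mu> d e a b c] comaximal_conic_coord[of \<mu> d e a c b]
      comaximal_conic_coord[of \<mu> d e b c a] distinct \<mu>
    by (auto simp: x_def y_def z_def conic_coord_commute[of d e \<mu> c b]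
        conic_coord_commute[of d e \<mu> c a] conic_coord_commute[of d e \<mu> b a] intro: comaximal_sym)
  have lin: "comaximal x [:-t, 1:] \<and> comaximal y [:-t, 1:] \<and> comaximal z [:-t, 1:]"
    if "t \<in> {0, d, e, \<mu>}" for t
    using that distinct \<mu> unfolding x_def y_def z_def
    by (intro conjI comaximal_linear poly_conic_coord_nonzero) auto
  define gs where "gs = [x, y, z, [:-0, 1:], [:-d, 1:], [:-e, 1:], [:-\<mu>, 1:]]"
  have "d \<noteq> \<mu>" "e \<noteq> \<mu>" "0 \<noteq> \<mu>" using \<mu> by auto
  then have sorted: "sorted_wrt comaximal gs"
    using xy xz yz lin[of 0] lin[of d] lin[of e] lin[of \<mu>]
      comaximal_linear_linear[of 0 d] comaximal_linear_linear[of 0 e] comaximal_linear_linear[of 0 \<mu>]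
      comaximal_linear_linear[of d e] comaximal_linear_linear[of d \<mu>] comaximal_linear_linear[of e \<mu>]
      distinct(1)
    by (simp add: gs_def)
  have f': "f \<in> ideal_power (point_ideal P) m" if "P \<in> {P1, P2, P3, P4, Q1, Q2, Q3}" for P
    using f(1) that by (auto simp: symbolic_power_def)
  \<comment> \<open>Modulo x only the summand yz q1 of the curve survives, so the curve is at Q1
    there; likewise for y and z.\<close>
  have "x ^ m dvd ?F"
    by (rule power_dvd_subst_poly3_ideal_power[OF Q(1) _ f', where c = "y * z"])
      (auto simp: \<phi>_def quartic_curve_def simp del: mult_pCons_left mult_pCons_right)
  moreover have "y ^ m dvd ?F"
    by (rule power_dvd_subst_poly3_ideal_power[OF Q(2) _ f', where c = "x * z"])
      (auto simp: \<phi>_def quartic_curve_def simp del: mult_pCons_left mult_pCons_right)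
  moreover have "z ^ m dvd ?F"
    by (rule power_dvd_subst_poly3_ideal_power[OF Q(3) _ f', where c = "x * y"])
      (auto simp: \<phi>_def quartic_curve_def simp del: mult_pCons_left mult_pCons_right)
  moreover have lin_dvd: "[:-t, 1:] ^ m dvd ?F"
    if "p \<in> P" "P \<in> {P1, P2, P3, P4, Q1, Q2, Q3}" "\<And>i. poly (\<phi> i) t = k * p $ i" for t p P k
    by (rule power_dvd_subst_poly3_ideal_power[OF that(1) _ f'[OF that(2)], where c = "[:k:]"])
      (use linear_dvd_diff_const[OF that(3)] in \<open>simp add: mult.commute\<close>)
  \<comment> \<open>The Cremona map is an involution up to scaling: if (x, y, z) is proportional to
    (BC, AC, AB), the image is proportional to (A, B, C).\<close>
  have at_point: "poly (\<phi> i) t = k\<^sup>2 * (A * B * C) * (A *s q1 + B *s q2 + C *s q3) $ i"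
    if "poly x t = k * (B * C)" "poly y t = k * (A * C)" "poly z t = k * (A * B)" for i t k A B C
    by (simp add: \<phi>_def quartic_curve_def that power2_eq_square algebra_simps)
  have P1: "1 *s q1 + 1 *s q2 + 1 *s q3 \<in> P1" using P(1) by simp
  have "[:-0, 1:] ^ m dvd ?F"
    by (rule lin_dvd[OF P(2) _ at_point[of 0 "\<mu>" "b" "c" "a"]])
      (simp_all add: x_def y_def z_def poly_conic_coord algebra_simps)
  moreover have "[:-d, 1:] ^ m dvd ?F"
    by (rule lin_dvd[OF P(3) _ at_point[of d "\<mu> - d" "d - b" "d - c" "d - a"]])
      (simp_all add: x_def y_def z_def poly_conic_coord algebra_simps)
  moreover have "[:-e, 1:] ^ m dvd ?F"
    by (rule lin_dvd[OF P(4) _ at_point[of e "\<mu> - e" "e - b" "e - c" "e - a"]])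
      (simp_all add: x_def y_def z_def poly_conic_coord algebra_simps)
  moreover have "[:-\<mu>, 1:] ^ m dvd ?F"
    \<comment> \<open>At \<mu> the three quadratics take the same value, which the Cremona map sends
      to the unit point q1 + q2 + q3.\<close>
    by (rule lin_dvd[OF P1 _ at_point[of \<mu> "\<mu> * ((\<mu> - d) * (\<mu> - e))" "1" "1" "1"]])
      (simp_all add: x_def y_def z_def poly_conic_coord algebra_simps)
  ultimately have "prod_list gs ^ m dvd ?F"
    by (intro prod_list_power_dvd[OF sorted]) (auto simp: gs_def)
  then have "degree (prod_list gs ^ m) \<le> degree ?F"
    using F by (rule dvd_imp_degree_le)
  moreover have "x \<noteq> 0" "y \<noteq> 0" "z \<noteq> 0" using deg by auto
  then have "degree (prod_list gs) = 10" "prod_list gs \<noteq> 0"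
    using deg by (simp_all add: gs_def degree_mult_eq del: mult_pCons_left mult_pCons_right)
  then have "degree (prod_list gs ^ m) = 10 * m"
    by (simp add: degree_power_eq)
  moreover have "degree ?F \<le> 4 * D"
  proof (rule degree_subst_poly3_le[OF f(2)])
    fix i
    have "degree (p * q * [:k:]) \<le> 4" if "degree p = 2" "degree q = 2" for p q :: "'k poly" and k
      using degree_mult_le[of "p * q" "[:k:]"] degree_mult_le[of p q] that by simp
    then show "degree (\<phi> i) \<le> 4"
      unfolding \<phi>_def quartic_curve_def by (intro degree_add_le) (use deg in blast)+
  qed
  ultimately show ?thesis by linarith
qed

section \<open>Genericity: the pencil sweeps out the plane\<close>

definition cremona :: "'k::field^3 \<Rightarrow> 'k^3 \<Rightarrow> 'k^3 \<Rightarrow> 'k \<Rightarrow> 'k \<Rightarrow> 'k \<Rightarrow> 'k^3" where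
  "cremona q1 q2 q3 x y z = (y * z) *s q1 + (x * z) *s q2 + (x * y) *s q3"

lemma cremona_scale: "cremona q1 q2 q3 (r * x) (r * y) (r * z) = r\<^sup>2 *s cremona q1 q2 q3 x y z"
  by (simp add: cremona_def vec_eq_iff power2_eq_square algebra_simps)

lemma poly_subst_quartic_curve:
  "poly (subst_poly3 (quartic_curve q1 q2 q3 x y z) f) t =
    eval_poly3 f (cremona q1 q2 q3 (poly x t) (poly y t) (poly z t))"
proof -
  have "(\<chi> i. poly (quartic_curve q1 q2 q3 x y z i) t) = cremona q1 q2 q3 (poly x t) (poly y t) (poly z t)"
    by (simp add: vec_eq_iff quartic_curve_def cremona_def)
  then show ?thesis by (simp add: poly_subst_poly3)
qed

text \<open>A generic point is the Cremona image of some (x : y : z), which is to be written in the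
  coordinates (1 : s : \<zeta>) of the plane of conics. Points on the triangle, where the Cremona
  map degenerates, and points without such affine coordinates lie in the zero sets of two nonzero
  functions and are avoided.\<close>

lemma generic_conic_parameters:
  fixes f :: "'k::field_char_0 poly3"
  assumes distinct: "distinct [a, b, c]"
    and span: "\<And>v. \<exists>\<alpha> \<beta> \<gamma>. v = \<alpha> *s q1 + \<beta> *s q2 + \<gamma> *s q3"
    and f: "f \<noteq> 0" "homogeneous_poly3 D f"
  obtains s \<zeta> where "eval_poly3 f (cremona q1 q2 q3 (\<zeta> - (b + c) * s + b * c)
    (\<zeta> - (a + c) * s + a * c) (\<zeta> - (a + b) * s + a * b)) \<noteq> 0"
proof -
  define h where "h v = (v $ 1) *s q1 + (v $ 2) *s q2 + (v $ 3) *s q3" for v :: "'k^3"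
  \<comment> \<open>Up to the nonzero constant (b - a)(c - b)(c - a), this is the first coordinate
    of the transformed point. It comes from eliminating s and \<zeta>, using x - y = r (b - a)(c -
    s) and y - z = r (c - b)(a - s).\<close>
  define R where
    "R v = (c - b) * (v $ 2 * v $ 3 - v $ 1 * v $ 3) - (b - a) * (v $ 1 * v $ 3 - v $ 1 * v $ 2)"
    for v :: "'k^3"
  obtain u where "eval_poly3 f u \<noteq> 0" using eval_poly3_nonzero[OF f(1)] .
  moreover obtain \<alpha> \<beta> \<gamma> where "u = \<alpha> *s q1 + \<beta> *s q2 + \<gamma> *s q3" using span by blast
  ultimately have "eval_poly3 f (h (vector [\<alpha>, \<beta>, \<gamma>])) \<noteq> 0" by (simp add: h_def)
  moreover have "line_poly (\<lambda>v. eval_poly3 f (h v))"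
    by (rule line_poly_eval_poly3) (simp add: h_def, intro line_poly_intros)
  moreover obtain w where "(w $ 1 * (w $ 2 * w $ 3)) * R w \<noteq> 0"
  proof (rule line_poly_mult_nonzero)
    show "line_poly (\<lambda>w. w $ 1 * (w $ 2 * w $ 3))" "line_poly R"
      unfolding R_def by (intro line_poly_intros)+
    show "(vector [1, 1, 1] :: 'k^3) $ 1 * ((vector [1, 1, 1] :: 'k^3) $ 2 * (vector [1, 1, 1] :: 'k^3) $ 3) \<noteq> 0"
      by simp
    show "R (vector [0, 1, 1]) \<noteq> 0" using distinct by (auto simp: R_def)
  qed
  moreover have "line_poly (\<lambda>w. (w $ 1 * (w $ 2 * w $ 3)) * R w)"
    unfolding R_def by (intro line_poly_intros)
  ultimately obtain v where v: "eval_poly3 f (h v) * ((v $ 1 * (v $ 2 * v $ 3)) * R v) \<noteq> 0"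
    using line_poly_mult_nonzero by blast
  define x where "x = v $ 2 * v $ 3"
  define y where "y = v $ 1 * v $ 3"
  define z where "z = v $ 1 * v $ 2"
  define r where "r = R v / ((b - a) * (c - b) * (c - a))"
  \<comment> \<open>Solves x - y = r (b - a)(c - s) for s; the formula for x then determines
    \<zeta>.\<close>
  define s where "s = c - (x - y) / ((b - a) * r)"
  define \<zeta> where "\<zeta> = x / r + (b + c) * s - b * c"
  have ne: "b - a \<noteq> 0" "c - b \<noteq> 0" "c - a \<noteq> 0" "r \<noteq> 0"
    using distinct v by (auto simp: r_def)
  have r: "r * ((b - a) * (c - b) * (c - a)) = (c - b) * (x - y) - (b - a) * (y - z)"
    using ne by (simp add: r_def R_def x_def y_def z_def)
  have s: "(b - a) * (r * (c - s)) = x - y" using ne by (simp add: s_def)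
  have x: "r * (\<zeta> - (b + c) * s + b * c) = x" using ne by (simp add: \<zeta>_def)
  have "r * (\<zeta> - (a + c) * s + a * c) =
      r * (\<zeta> - (b + c) * s + b * c) - (b - a) * (r * (c - s))"
    by (simp add: algebra_simps)
  then have y: "r * (\<zeta> - (a + c) * s + a * c) = y"
    unfolding x s by simp
  have "(b - a) * (r * (\<zeta> - (a + b) * s + a * b)) =
      (b - a) * (r * (\<zeta> - (a + c) * s + a * c)) - (c - b) * ((b - a) * (r * (c - s))) +
      r * ((b - a) * (c - b) * (c - a))"
    by (simp add: algebra_simps)
  then have "(b - a) * (r * (\<zeta> - (a + b) * s + a * b)) = (b - a) * z"
    unfolding y s r by (simp add: algebra_simps)
  then have z: "r * (\<zeta> - (a + b) * s + a * b) = z" using ne by simp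
  \<comment> \<open>Since x, y, z are already the pairwise products of the coordinates of v, this is
    the second application of the Cremona map and returns v up to the factor v1 v2 v3.\<close>
  have "cremona q1 q2 q3 x y z = (v $ 1 * (v $ 2 * v $ 3)) *s h v"
    by (simp add: cremona_def h_def x_def y_def z_def vec_eq_iff algebra_simps)
  then have "eval_poly3 f (cremona q1 q2 q3 x y z) \<noteq> 0"
    using v by (simp add: eval_poly3_scale[OF f(2)])
  then have "eval_poly3 f (cremona q1 q2 q3 (\<zeta> - (b + c) * s + b * c)
    (\<zeta> - (a + c) * s + a * c) (\<zeta> - (a + b) * s + a * b)) \<noteq> 0"
    unfolding x[symmetric] y[symmetric] z[symmetric] cremona_scale eval_poly3_scale[OF f(2)]
    by simp
  then show ?thesis by (rule that)
qed

text \<open>The member through (1 : s : \<zeta>) satisfies \<mu> (\<zeta> - s^2) = s (\<zeta> - w).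
  First s is moved off 0, d, e with \<zeta> fixed; then \<zeta> is moved so that this equation has a
  solution \<mu> outside K.\<close>

lemma generic_curve:
  fixes f :: "'k::field_char_0 poly3"
  assumes distinct: "distinct [0, d, e]" "distinct [a, b, c]"
    and span: "\<And>v. \<exists>\<alpha> \<beta> \<gamma>. v = \<alpha> *s q1 + \<beta> *s q2 + \<gamma> *s q3"
    and f: "f \<noteq> 0" "homogeneous_poly3 D f"
    and K: "finite K"
  obtains \<mu> where "\<mu> \<notin> K" "subst_poly3 (quartic_curve q1 q2 q3 (conic_coord d e \<mu> b c)
      (conic_coord d e \<mu> a c) (conic_coord d e \<mu> a b)) f \<noteq> 0"
proof -
  define G where "G s \<zeta> = eval_poly3 f (cremona q1 q2 q3 (\<zeta> - (b + c) * s + b * c)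
    (\<zeta> - (a + c) * s + a * c) (\<zeta> - (a + b) * s + a * b))" for s \<zeta>
  obtain s\<^sub>0 \<zeta>\<^sub>0 where G0: "G s\<^sub>0 \<zeta>\<^sub>0 \<noteq> 0"
    using generic_conic_parameters[OF distinct(2) span f] unfolding G_def .
  define p where "p = subst_poly3 (quartic_curve q1 q2 q3 [:\<zeta>\<^sub>0 + b * c, - (b + c):]
    [:\<zeta>\<^sub>0 + a * c, - (a + c):] [:\<zeta>\<^sub>0 + a * b, - (a + b):]) f"
  have p: "G s \<zeta>\<^sub>0 = poly p s" for s
    by (simp add: p_def G_def poly_subst_quartic_curve algebra_simps)
  have "p * ([:0, 1:] * ([:-d, 1:] * [:-e, 1:])) \<noteq> 0"
    using G0 p by (auto simp del: mult_pCons_left mult_pCons_right)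
  then obtain s where "poly (p * ([:0, 1:] * ([:-d, 1:] * [:-e, 1:]))) s \<noteq> 0"
    using poly_all_0_iff_0 by blast
  then have s: "s \<noteq> 0" "s \<noteq> d" "s \<noteq> e" "poly p s \<noteq> 0"
    by (auto simp only: poly_mult mult_eq_0_iff poly_pCons poly_0) auto
  define w where "w = (d + e) * s - d * e"
  \<comment> \<open>This keeps s (\<zeta> - w) / (\<zeta> - s^2) from being constant in
    \<zeta>.\<close>
  have sw: "s\<^sup>2 - w \<noteq> 0"
  proof -
    have "s\<^sup>2 - w = (s - d) * (s - e)" by (simp add: w_def power2_eq_square algebra_simps)
    then show ?thesis using s by simp
  qed
  define q where "q = subst_poly3 (quartic_curve q1 q2 q3 [:b * c - (b + c) * s, 1:]
    [:a * c - (a + c) * s, 1:] [:a * b - (a + b) * s, 1:]) f"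
  have q: "G s \<zeta> = poly q \<zeta>" for \<zeta>
    by (simp add: q_def G_def poly_subst_quartic_curve algebra_simps)
  \<comment> \<open>A polynomial in \<zeta>, equal to s (\<zeta> - w) - \<kappa> (\<zeta> - s^2): it
    vanishes when the member through (1 : s : \<zeta>) has parameter \<kappa>.\<close>
  define excl where "excl \<kappa> = [:\<kappa> * s\<^sup>2 - s * w, s - \<kappa>:]" for \<kappa>
  have "excl \<kappa> \<noteq> 0" for \<kappa>
  proof
    assume "excl \<kappa> = 0"
    then have "s - \<kappa> = 0" "\<kappa> * s\<^sup>2 - s * w = 0" by (auto simp: excl_def)
    then have "s * (s\<^sup>2 - w) = 0" by (simp add: algebra_simps)
    then show False using s sw by simp
  qed
  moreover have "q \<noteq> 0"
  proof
    assume "q = 0"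
    then show False using s(4) p[of s] q[of \<zeta>\<^sub>0] by simp
  qed
  ultimately have "q * ([:- s\<^sup>2, 1:] * (\<Prod>\<kappa>\<in>K. excl \<kappa>)) \<noteq> 0"
    using K by (simp del: mult_pCons_left mult_pCons_right)
  then obtain \<zeta> where "poly (q * ([:- s\<^sup>2, 1:] * (\<Prod>\<kappa>\<in>K. excl \<kappa>))) \<zeta> \<noteq> 0"
    using poly_all_0_iff_0 by blast
  then have \<zeta>: "G s \<zeta> \<noteq> 0" "\<zeta> - s\<^sup>2 \<noteq> 0" "\<And>\<kappa>. \<kappa> \<in> K \<Longrightarrow> poly (excl \<kappa>) \<zeta> \<noteq> 0"
    using K by (auto simp: q poly_prod)
  define \<mu> where "\<mu> = s * (\<zeta> - w) / (\<zeta> - s\<^sup>2)"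
  have \<mu>: "\<mu> * (\<zeta> - s\<^sup>2) = s * (\<zeta> - w)" using \<zeta>(2) by (simp add: \<mu>_def)
  have "\<mu> \<notin> K"
  proof
    assume "\<mu> \<in> K"
    then have "poly (excl \<mu>) \<zeta> \<noteq> 0" by (rule \<zeta>(3))
    moreover have "poly (excl \<mu>) \<zeta> = s * (\<zeta> - w) - \<mu> * (\<zeta> - s\<^sup>2)"
      by (simp add: excl_def algebra_simps)
    ultimately show False using \<mu> by simp
  qed
  moreover have "\<mu> \<noteq> s"
  proof
    assume "\<mu> = s"
    then have "s * (s\<^sup>2 - w) = 0" using \<mu> by (auto simp: algebra_simps)
    then show False using s sw by simp
  qed
  \<comment> \<open>At its parameter s the chosen conic passes through (1 : s : \<zeta>), scaled by
    its first coordinate \<mu> - s, which is nonzero.\<close>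
  moreover have "poly (conic_coord d e \<mu> b' c') s = (\<mu> - s) * (\<zeta> - (b' + c') * s + b' * c')" for b' c'
    using \<mu> unfolding poly_conic_coord w_def by algebra
  then have "poly (subst_poly3 (quartic_curve q1 q2 q3 (conic_coord d e \<mu> b c)
      (conic_coord d e \<mu> a c) (conic_coord d e \<mu> a b)) f) s = ((\<mu> - s)\<^sup>2) ^ D * G s \<zeta>"
    by (simp add: poly_subst_quartic_curve cremona_scale eval_poly3_scale[OF f(2)] G_def)
  ultimately show ?thesis using that \<zeta>(1) by force
qed

lemma multiplicity_bound_generic:
  fixes f :: "'k::field_char_0 poly3" and q1 q2 q3 :: "'k^3"
  assumes "distinct [0, d, e]" "a \<notin> {0, d, e}" "b \<notin> {0, d, e}" "c \<notin> {0, d, e}"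
      "distinct [a, b, c]"
    and "q1 \<in> Q1" "q2 \<in> Q2" "q3 \<in> Q3"
    and "q1 + q2 + q3 \<in> P1" "a *s q1 + b *s q2 + c *s q3 \<in> P2"
      "(d - a) *s q1 + (d - b) *s q2 + (d - c) *s q3 \<in> P3"
      "(e - a) *s q1 + (e - b) *s q2 + (e - c) *s q3 \<in> P4"
    and "\<And>v. \<exists>\<alpha> \<beta> \<gamma>. v = \<alpha> *s q1 + \<beta> *s q2 + \<gamma> *s q3"
    and "f \<in> symbolic_power {P1, P2, P3, P4, Q1, Q2, Q3} m" "homogeneous_poly3 D f" "f \<noteq> 0"
  shows "10 * m \<le> 4 * D"
proof -
  obtain \<mu> where "\<mu> \<notin> {0, d, e, d + e - b - c, d + e - a - c, d + e - a - b}"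
    "subst_poly3 (quartic_curve q1 q2 q3 (conic_coord d e \<mu> b c)
      (conic_coord d e \<mu> a c) (conic_coord d e \<mu> a b)) f \<noteq> 0"
    by (rule generic_curve[OF assms(1,5,13,16,15),
          where K = "{0, d, e, d + e - b - c, d + e - a - c, d + e - a - b}"]) auto
  then show ?thesis using multiplicity_bound assms by blast
qed

section \<open>Products of linear forms and the limit\<close>

definition linear_form :: "'k::field^3 \<Rightarrow> 'k poly3" where
  "linear_form w = (\<Sum>i\<in>UNIV. Poly_Mapping.single (Poly_Mapping.single i 1) (w $ i))"

lemma homogeneous_linear_form: "homogeneous_poly3 1 (linear_form w)"
  unfolding homogeneous_poly3_def
proof
  fix e assume "e \<in> Poly_Mapping.keys (linear_form w)"
  then obtain i where "Poly_Mapping.lookup (Poly_Mapping.single (Poly_Mapping.single i 1) (w $ i)) e \<noteq> 0"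
    unfolding in_keys_iff linear_form_def lookup_sum by (meson sum.neutral)
  then have "e = Poly_Mapping.single i 1" by (metis lookup_single_not_eq)
  then show "(\<Sum>i\<in>UNIV. Poly_Mapping.lookup e i) = 1"
    by (simp add: lookup_single when_def)
qed

lemma eval_linear_form: "eval_poly3 (linear_form w) v = (\<Sum>i\<in>UNIV. w $ i * v $ i)"
proof -
  have "(\<Prod>j\<in>UNIV. [:v $ j:] ^ (1 when i = j)) = (\<Prod>j\<in>UNIV. if i = j then [:v $ j:] else 1)" for i :: 3
    by (intro prod.cong) (auto simp: when_def)
  \<comment> \<open>Evaluation is read off from substitution of constants, where the additivity
    lemmas apply.\<close>
  then have "[:eval_poly3 (linear_form w) v:] = [:\<Sum>i\<in>UNIV. w $ i * v $ i:]"
    unfolding subst_poly3_const[symmetric]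
    by (simp add: linear_form_def subst_poly3_sum subst_poly3_single lookup_single sum_to_poly)
  then show ?thesis by simp
qed

lemma linear_form_nonzero:
  assumes "w \<noteq> 0"
  shows "linear_form w \<noteq> 0"
proof
  assume 0: "linear_form w = 0"
  have "eval_poly3 (linear_form w) (axis i 1) = w $ i" for i
    by (simp add: eval_linear_form axis_def if_distrib cong: if_cong)
  then have "w $ i = 0" for i by (simp add: 0 eval_poly3_def)
  then show False using assms by (simp add: vec_eq_iff)
qed

text \<open>A kernel vector of the singular matrix with rows a, b, 0. Unlike the cross product it is
  nonzero even when a and b are dependent.\<close>

lemma exists_annihilator:
  fixes a b :: "'k::field^3"
  obtains w where "w \<noteq> 0" "(\<Sum>i\<in>UNIV. w $ i * a $ i) = 0" "(\<Sum>i\<in>UNIV. w $ i * b $ i) = 0"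
proof -
  define A :: "'k^3^3" where "A = vector [a, b, 0]"
  have "row 3 A = 0" by (simp add: row_def A_def vec_eq_iff)
  then have "det A = 0" by (rule det_zero_row)
  then have "\<not> invertible A" by (simp add: invertible_det_nz)
  then obtain w where w: "A *v w = 0" "w \<noteq> 0"
    using matrix_left_invertible_ker invertible_left_inverse by blast
  then have "(A *v w) $ 1 = 0" "(A *v w) $ 2 = 0" by auto
  then show ?thesis
    using that[OF w(2)] by (simp add: matrix_vector_mult_def A_def mult.commute)
qed

lemma linear_form_in_point_ideal:
  assumes "\<And>v. v \<in> P \<Longrightarrow> eval_poly3 (linear_form w) v = 0"
  shows "linear_form w \<in> point_ideal P"
  unfolding point_ideal_def ideal_generated_def
  by (rule module.span_base[OF module_times]) (use assms homogeneous_linear_form in blast)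

lemma homogeneous_poly3_mult:
  assumes "homogeneous_poly3 d f" "homogeneous_poly3 e g"
  shows "homogeneous_poly3 (d + e) (f * g)"
  unfolding homogeneous_poly3_def
proof
  fix k assume "k \<in> Poly_Mapping.keys (f * g)"
  then obtain a b where "k = a + b" "a \<in> Poly_Mapping.keys f" "b \<in> Poly_Mapping.keys g"
    using keys_mult[of f g] by blast
  then show "(\<Sum>i\<in>UNIV. Poly_Mapping.lookup k i) = d + e"
    using assms by (auto simp: homogeneous_poly3_def lookup_add sum.distrib)
qed

lemma homogeneous_poly3_power:
  assumes "homogeneous_poly3 d f"
  shows "homogeneous_poly3 (n * d) (f ^ n)"
proof (induction n)
  case 0
  then show ?case by (simp add: homogeneous_poly3_def)
next
  case (Suc n)
  then show ?case using homogeneous_poly3_mult[OF assms] by simp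
qed

section \<open>Explicit elements of ideal powers and of symbolic powers\<close>

lemma prod_in_ideal_power:
  assumes "\<And>i. i < m \<Longrightarrow> g i \<in> I"
  shows "h * (\<Prod>i<m. g i) \<in> ideal_power I m"
  unfolding ideal_power_def ideal_generated_def
  by (intro module.span_scale[OF module_times] module.span_base[OF module_times])
    (use assms in blast)

lemma power_in_ideal_power:
  assumes "l \<in> I"
  shows "h * l ^ m \<in> ideal_power I m"
  using prod_in_ideal_power[of m "\<lambda>_. l" I h] assms by simp

text \<open>The product has 2k factors in the ideal: the first m give the element of the power, the
  rest are absorbed into the cofactor.\<close>

lemma power_mult_power_in_ideal_power:
  assumes "l \<in> I" "l' \<in> I" "m \<le> 2 * k"
  shows "h * (l ^ k * l' ^ k) \<in> ideal_power I m"
proof -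
  define g where "g i = (if i < k then l else l')" for i
  have "(\<Prod>i<2 * k. g i) = (\<Prod>i\<in>{..<k} \<union> {k..<2 * k}. g i)"
    by (intro prod.cong) auto
  also have "\<dots> = l ^ k * l' ^ k"
    by (subst prod.union_disjoint) (auto simp: g_def)
  finally have "l ^ k * l' ^ k = (\<Prod>i<2 * k. g i)" ..
  also have "\<dots> = (\<Prod>i\<in>{..<m} \<union> {m..<2 * k}. g i)"
    using assms(3) by (intro prod.cong) auto
  also have "\<dots> = (\<Prod>i<m. g i) * (\<Prod>i\<in>{m..<2 * k}. g i)"
    by (subst prod.union_disjoint) auto
  finally have "h * (l ^ k * l' ^ k) = (h * (\<Prod>i\<in>{m..<2 * k}. g i)) * (\<Prod>i<m. g i)"
    by (simp add: mult_ac)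
  also have "\<dots> \<in> ideal_power I m"
    by (intro prod_in_ideal_power) (use assms in \<open>simp add: g_def\<close>)
  finally show ?thesis .
qed

text \<open>The witness is l^m (l1 l2 l3)^k. The factor l^m serves all points other than the Qi,
  however many there are; through each Qi pass two of the three sides, giving multiplicity
  2k.\<close>

lemma symbolic_power_element:
  fixes l l1 l2 l3 :: "'k::field poly3"
  assumes nonzero: "l \<noteq> 0" "l1 \<noteq> 0" "l2 \<noteq> 0" "l3 \<noteq> 0"
    and hom: "homogeneous_poly3 1 l" "homogeneous_poly3 1 l1" "homogeneous_poly3 1 l2" "homogeneous_poly3 1 l3"
    and L: "\<And>P. P \<in> Z - {Q1, Q2, Q3} \<Longrightarrow> l \<in> point_ideal P"
    and Q: "l2 \<in> point_ideal Q1" "l3 \<in> point_ideal Q1" "l1 \<in> point_ideal Q2"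
      "l3 \<in> point_ideal Q2" "l1 \<in> point_ideal Q3" "l2 \<in> point_ideal Q3"
    and m: "m \<le> 2 * k"
  shows "\<exists>f\<in>symbolic_power Z m. f \<noteq> 0 \<and> homogeneous_poly3 (m + 3 * k) f"
proof (intro bexI conjI)
  let ?f = "l ^ m * (l1 ^ k * (l2 ^ k * l3 ^ k))"
  show "?f \<noteq> 0" using nonzero by simp
  have "homogeneous_poly3 (m * 1 + (k * 1 + (k * 1 + k * 1))) ?f"
    by (intro homogeneous_poly3_mult homogeneous_poly3_power hom)
  moreover have "m * 1 + (k * 1 + (k * 1 + k * 1)) = m + 3 * k" by simp
  ultimately show "homogeneous_poly3 (m + 3 * k) ?f" by (simp only:)
  have "?f \<in> ideal_power (point_ideal P) m" if PZ: "P \<in> Z" for P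
  proof -
    consider "P = Q1" | "P = Q2" | "P = Q3" | "P \<in> Z - {Q1, Q2, Q3}" using PZ by blast
    then show ?thesis
    proof cases
      case 1
      then show ?thesis
        using power_mult_power_in_ideal_power[OF Q(1,2) m, of "l ^ m * l1 ^ k"] by (simp add: mult_ac)
    next
      case 2
      then show ?thesis
        using power_mult_power_in_ideal_power[OF Q(3,4) m, of "l ^ m * l2 ^ k"] by (simp add: mult_ac)
    next
      case 3
      then show ?thesis
        using power_mult_power_in_ideal_power[OF Q(5,6) m, of "l ^ m * l3 ^ k"] by (simp add: mult_ac)
    next
      case 4
      then show ?thesis
        using power_in_ideal_power[OF L, of P "l1 ^ k * (l2 ^ k * l3 ^ k)" m] by (simp add: mult_ac)
    qed
  qed
  then show "?f \<in> symbolic_power Z m" by (simp add: symbolic_power_def)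
qed

text \<open>The lower bound is exactly 5/2 at every positive m; rounding m/2 up to an integer costs
  at most 3/2 in degree, which disappears after division by m.\<close>

lemma waldschmidt_eqI:
  assumes lower: "\<And>m D f. f \<in> symbolic_power Z m \<Longrightarrow> homogeneous_poly3 D f \<Longrightarrow> f \<noteq> 0 \<Longrightarrow> 10 * m \<le> 4 * D"
    and upper: "\<And>m k. m \<le> 2 * k \<Longrightarrow>
      \<exists>f\<in>symbolic_power Z m. f \<noteq> 0 \<and> homogeneous_poly3 (m + 3 * k) f"
  shows "waldschmidt Z = 5 / 2"
proof -
  define \<alpha> where "\<alpha> m = initial_degree (symbolic_power Z m)" for m
  have "10 * m \<le> 4 * \<alpha> m \<and> 2 * \<alpha> m \<le> 5 * m + 3" for m
  proof -
    let ?k = "(m + 1) div 2"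
    have ex: "\<exists>f\<in>symbolic_power Z m. f \<noteq> 0 \<and> homogeneous_poly3 (m + 3 * ?k) f"
      by (rule upper) simp
    \<comment> \<open>The explicit element also shows that the least degree is attained, so the
      lower bound applies to it.\<close>
    then have "\<exists>f\<in>symbolic_power Z m. f \<noteq> 0 \<and> homogeneous_poly3 (\<alpha> m) f"
      unfolding \<alpha>_def initial_degree_def by (rule LeastI)
    moreover have "\<alpha> m \<le> m + 3 * ?k"
      unfolding \<alpha>_def initial_degree_def using ex by (rule Least_le)
    moreover have "2 * ?k \<le> m + 1" by simp
    ultimately show ?thesis using lower[of _ m "\<alpha> m"] by fastforce
  qed
  then have "real (10 * m) \<le> real (4 * \<alpha> m)" "real (2 * \<alpha> m) \<le> real (5 * m + 3)" for m
    unfolding of_nat_le_iff by blast+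
  then have bounds: "5 / 2 \<le> real (\<alpha> m) / real m" "real (\<alpha> m) / real m \<le> 5 / 2 + (3 / 2) / real m"
    if "m > 0" for m
    using that by (auto simp: field_simps)
  have "(\<lambda>m. 5 / 2 + (3 / 2) / real m) \<longlonglongrightarrow> 5 / 2 + 0"
    by (intro tendsto_add tendsto_const lim_const_over_n)
  then have lim: "(\<lambda>m. 5 / 2 + (3 / 2) / real m) \<longlonglongrightarrow> 5 / 2" by simp
  have "(\<lambda>m. real (\<alpha> m) / real m) \<longlonglongrightarrow> 5 / 2"
  proof (rule tendsto_sandwich[OF _ _ tendsto_const lim])
    show "\<forall>\<^sub>F m in sequentially. 5 / 2 \<le> real (\<alpha> m) / real m"
      by (rule eventually_sequentiallyI[of 1], rule bounds(1)) simp
    show "\<forall>\<^sub>F m in sequentially. real (\<alpha> m) / real m \<le> 5 / 2 + (3 / 2) / real m"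
      by (rule eventually_sequentiallyI[of 1], rule bounds(2)) simp
  qed
  then show ?thesis by (simp add: waldschmidt_def \<alpha>_def limI)
qed

section \<open>Coordinates adapted to the configuration\<close>

lemma proj_point_eq_span:
  assumes "P \<in> proj_points" "p \<in> P" "p \<noteq> 0"
  shows "P = vec.span {p}"
proof -
  have "vec.independent {p}" using assms by simp
  moreover have "vec.subspace P" "vec.dim P = 1" using assms by (auto simp: proj_points_def)
  ultimately show ?thesis
    using assms vec.card_ge_dim_independent[of "{p}" P] vec.span_minimal[of "{p}" P] by auto
qed

lemma proj_point_obtain:
  assumes "P \<in> proj_points"
  obtains p where "p \<in> P" "p \<noteq> 0"
proof -
  have "\<not> P \<subseteq> {0}" using assms vec.dim_le_card[of P "{}"] by (auto simp: proj_points_def)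
  then show ?thesis using that by blast
qed

lemma proj_points_eqI:
  assumes "P \<in> proj_points" "P' \<in> proj_points" "p \<in> P" "p \<in> P'" "p \<noteq> 0"
  shows "P = P'"
  using assms proj_point_eq_span by metis

text \<open>If q3 were in the span of q1 and q2, that plane would be a projective line containing
  all three points. Hence the three vectors are independent in dimension 3.\<close>

lemma triangle_basis:
  assumes Q: "Q1 \<in> proj_points" "Q2 \<in> proj_points" "Q3 \<in> proj_points" "Q1 \<noteq> Q2"
    and collinear: "\<not> proj_collinear {Q1, Q2, Q3}"
    and q: "q1 \<in> Q1" "q2 \<in> Q2" "q3 \<in> Q3" "q1 \<noteq> 0" "q2 \<noteq> 0" "q3 \<noteq> 0"
  shows "\<exists>\<alpha> \<beta> \<gamma>. v = \<alpha> *s q1 + \<beta> *s q2 + \<gamma> *s q3"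
proof -
  have 12: "q2 \<notin> vec.span {q1}"
    using Q q proj_point_eq_span proj_points_eqI by metis
  then have ind12: "vec.independent {q2, q1}" "q1 \<noteq> q2"
    using q by (auto simp: vec.independent_insert vec.span_base)
  have "q3 \<notin> vec.span {q2, q1}"
  proof
    assume q3: "q3 \<in> vec.span {q2, q1}"
    have "vec.span {q2, q1} \<in> proj_lines"
      using ind12 by (simp add: proj_lines_def vec.dim_eq_card_independent)
    moreover have "P \<subseteq> vec.span {q2, q1}" if "P \<in> {Q1, Q2, Q3}" for P
    proof -
      have "P = vec.span {q1} \<or> P = vec.span {q2} \<or> P = vec.span {q3}"
        using that Q q proj_point_eq_span by blast
      moreover have "vec.span {r} \<subseteq> vec.span {q2, q1}" if "r \<in> {q1, q2, q3}" for r
        using that q3 by (intro vec.span_minimal) (auto simp: vec.span_base)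
      ultimately show ?thesis by blast
    qed
    ultimately have "proj_collinear {Q1, Q2, Q3}"
      unfolding proj_collinear_def by (intro bexI[of _ "vec.span {q2, q1}"] ballI)
    then show False using collinear by contradiction
  qed
  then have "vec.independent {q3, q2, q1}" "card {q3, q2, q1} = 3"
    using ind12 by (auto simp: vec.independent_insert vec.span_base card_insert_if)
  then have "vec.span {q3, q2, q1} = UNIV"
    using vec.card_ge_dim_independent[of "{q3, q2, q1}" UNIV] vec_dim_card[where 'a='a and 'n=3]
    by (simp del: vec.dim_UNIV add: top.extremum_unique)
  then have "v \<in> vec.span {q3, q2, q1}" by simp
  then obtain \<gamma> where "v - \<gamma> *s q3 \<in> vec.span {q2, q1}"
    using vec.span_breakdown_eq by blast
  then obtain \<beta> where "v - \<gamma> *s q3 - \<beta> *s q2 \<in> vec.span {q1}"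
    using vec.span_breakdown_eq by blast
  then obtain \<alpha> where "v - \<gamma> *s q3 - \<beta> *s q2 = \<alpha> *s q1"
    by (auto simp: vec.span_singleton)
  then have "v = \<alpha> *s q1 + \<beta> *s q2 + \<gamma> *s q3" by (simp add: algebra_simps)
  then show ?thesis by blast
qed

text \<open>A vanishing coordinate would place P on the side of the triangle spanned by the other
  two vectors.\<close>

lemma not_Q_collinear_coords_nonzero:
  assumes P: "P \<in> proj_points" "P \<notin> {Q1, Q2, Q3}" "\<not> Q_collinear Q1 Q2 Q3 P"
    and q: "q1 \<in> Q1" "q2 \<in> Q2" "q3 \<in> Q3"
    and v: "\<alpha> *s q1 + \<beta> *s q2 + \<gamma> *s q3 \<in> P" "\<alpha> *s q1 + \<beta> *s q2 + \<gamma> *s q3 \<noteq> 0"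
  shows "\<alpha> \<noteq> 0 \<and> \<beta> \<noteq> 0 \<and> \<gamma> \<noteq> 0"
proof -
  let ?v = "\<alpha> *s q1 + \<beta> *s q2 + \<gamma> *s q3"
  have "P \<subseteq> vec.span A" if "?v \<in> vec.span A" for A
    by (subst proj_point_eq_span[OF P(1) v], rule vec.span_minimal) (use that in auto)
  then have *: "?v \<notin> line_through Q2 Q3" "?v \<notin> line_through Q1 Q3" "?v \<notin> line_through Q1 Q2"
    using P(1) P(2) P(3) by (auto simp only: Q_collinear_def line_through_def)
  have mem: "r *s p + s *s p' \<in> line_through R R'" if "p \<in> R" "p' \<in> R'" for r s p p' and R R' :: "('a^3) set"
    unfolding line_through_def using that
    by (intro vec.span_add vec.span_scale) (auto intro: vec.span_base)
  show ?thesis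
  proof (intro conjI notI)
    assume "\<alpha> = 0" then show False using *(1) mem[OF q(2,3), of \<beta> \<gamma>] by simp
  next
    assume "\<beta> = 0" then show False using *(2) mem[OF q(1,3), of \<alpha> \<gamma>] by simp
  next
    assume "\<gamma> = 0" then show False using *(3) mem[OF q(1,2), of \<alpha> \<beta>] by simp
  qed
qed

lemma annihilator_in_point_ideal:
  assumes "P \<subseteq> vec.span {p, p'}"
    and "(\<Sum>i\<in>UNIV. w $ i * p $ i) = 0" "(\<Sum>i\<in>UNIV. w $ i * p' $ i) = 0"
  shows "linear_form w \<in> point_ideal P"
proof (rule linear_form_in_point_ideal)
  fix v assume "v \<in> P"
  then have "v \<in> vec.span {p, p'}" using assms(1) by blast
  then show "eval_poly3 (linear_form w) v = 0"
  proof (induction rule: vec.span_induct_alt)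
    case (step c x y)
    then show ?case
      using assms(2,3)
      by (auto simp: eval_linear_form distrib_left sum.distrib mult.left_commute simp flip: sum_distrib_left)
  qed (simp add: eval_linear_form)
qed

lemma vanishing_linear_form:
  obtains l where "l \<noteq> 0" "homogeneous_poly3 1 l" "\<And>P. P \<subseteq> vec.span {p, p'} \<Longrightarrow> l \<in> point_ideal P"
proof -
  obtain w where w: "w \<noteq> 0" "(\<Sum>i\<in>UNIV. w $ i * p $ i) = 0" "(\<Sum>i\<in>UNIV. w $ i * p' $ i) = 0"
    by (rule exists_annihilator)
  show ?thesis
    using that[OF linear_form_nonzero[OF w(1)] homogeneous_linear_form
        annihilator_in_point_ideal[OF _ w(2,3)]] .
qed

text \<open>Formulated for a set \<open>Z\<close> with arbitrarily many further points on
  \<open>L\<close>, so that it covers both X and Y.\<close>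

lemma waldschmidt_points_on_line_and_triangle:
  fixes P1 P2 P3 P4 Q1 Q2 Q3 L :: "('k::field_char_0^3) set"
  assumes points: "{P1, P2, P3, P4, Q1, Q2, Q3} \<subseteq> proj_points"
    and distinct: "distinct [P1, P2, P3, P4, Q1, Q2, Q3]"
    and L: "L \<in> proj_lines" "P1 \<subseteq> L" "P2 \<subseteq> L" "P3 \<subseteq> L" "P4 \<subseteq> L"
    and Q_not_L: "\<not> Q1 \<subseteq> L" "\<not> Q2 \<subseteq> L" "\<not> Q3 \<subseteq> L"
    and noncollinear: "\<not> proj_collinear {Q1, Q2, Q3}"
    and not_Q_collinear: "\<forall>P\<in>{P1, P2, P3, P4}. \<not> Q_collinear Q1 Q2 Q3 P"
    and Z: "{P1, P2, P3, P4, Q1, Q2, Q3} \<subseteq> Z" "\<forall>P\<in>Z - {P1, P2, P3, P4, Q1, Q2, Q3}. P \<subseteq> L"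
  shows "waldschmidt Z = 5 / 2"
proof -
  have subspace: "vec.subspace P" if "P \<in> {P1, P2, P3, P4, Q1, Q2, Q3, L}" for P
    using that points L(1) by (auto simp: proj_points_def proj_lines_def)
  have pt: "P1 \<in> proj_points" "P2 \<in> proj_points" "P3 \<in> proj_points" "P4 \<in> proj_points"
    "Q1 \<in> proj_points" "Q2 \<in> proj_points" "Q3 \<in> proj_points"
    using points by simp_all
  have ne: "P1 \<noteq> P2" "P1 \<noteq> P3" "P1 \<noteq> P4" "P2 \<noteq> P3" "P2 \<noteq> P4" "P3 \<noteq> P4" "Q1 \<noteq> Q2"
    using distinct by simp_all
  note basis = triangle_basis[OF pt(5-7) ne(7) noncollinear]
  obtain p1 where p1: "p1 \<in> P1" "p1 \<noteq> 0" by (rule proj_point_obtain[OF pt(1)])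
  obtain p2 where p2: "p2 \<in> P2" "p2 \<noteq> 0" by (rule proj_point_obtain[OF pt(2)])
  obtain p3 where p3: "p3 \<in> P3" "p3 \<noteq> 0" by (rule proj_point_obtain[OF pt(3)])
  obtain p4 where p4: "p4 \<in> P4" "p4 \<noteq> 0" by (rule proj_point_obtain[OF pt(4)])
  obtain r1 where r1: "r1 \<in> Q1" "r1 \<noteq> 0" by (rule proj_point_obtain[OF pt(5)])
  obtain r2 where r2: "r2 \<in> Q2" "r2 \<noteq> 0" by (rule proj_point_obtain[OF pt(6)])
  obtain r3 where r3: "r3 \<in> Q3" "r3 \<noteq> 0" by (rule proj_point_obtain[OF pt(7)])
  have coords: "\<alpha> \<noteq> 0 \<and> \<beta> \<noteq> 0 \<and> \<gamma> \<noteq> 0"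
    if "P \<in> {P1, P2, P3, P4}" "q1 \<in> Q1" "q2 \<in> Q2" "q3 \<in> Q3"
      "\<alpha> *s q1 + \<beta> *s q2 + \<gamma> *s q3 \<in> P" "\<alpha> *s q1 + \<beta> *s q2 + \<gamma> *s q3 \<noteq> 0"
    for P q1 q2 q3 \<alpha> \<beta> \<gamma>
  proof (rule not_Q_collinear_coords_nonzero[OF _ _ _ that(2-6)])
    show "P \<in> proj_points" using that(1) pt by (elim insertE emptyE) simp_all
    show "P \<notin> {Q1, Q2, Q3}" using that(1) distinct by (elim insertE emptyE) simp_all
    show "\<not> Q_collinear Q1 Q2 Q3 P" by (rule bspec[OF not_Q_collinear that(1)])
  qed
  obtain \<alpha> \<beta> \<gamma> where p1_eq: "p1 = \<alpha> *s r1 + \<beta> *s r2 + \<gamma> *s r3"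
    using basis[OF r1(1) r2(1) r3(1) r1(2) r2(2) r3(2)] by blast
  then have "\<alpha> \<noteq> 0" "\<beta> \<noteq> 0" "\<gamma> \<noteq> 0"
    using coords[OF _ r1(1) r2(1) r3(1), of P1 \<alpha> \<beta> \<gamma>] p1 by simp_all
  \<comment> \<open>Rescaling the representatives makes P1 the unit point q1 + q2 + q3.\<close>
  define q1 where "q1 = \<alpha> *s r1"
  define q2 where "q2 = \<beta> *s r2"
  define q3 where "q3 = \<gamma> *s r3"
  have q: "q1 \<in> Q1" "q2 \<in> Q2" "q3 \<in> Q3"
    using subspace r1 r2 r3 by (simp_all add: q1_def q2_def q3_def vec.subspace_scale)
  have q_nonzero: "q1 \<noteq> 0" "q2 \<noteq> 0" "q3 \<noteq> 0"
    using \<open>\<alpha> \<noteq> 0\<close> \<open>\<beta> \<noteq> 0\<close> \<open>\<gamma> \<noteq> 0\<close> r1 r2 r3 by (simp_all add: q1_def q2_def q3_def)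
  have p1_sum: "p1 = q1 + q2 + q3" by (simp add: p1_eq q1_def q2_def q3_def)
  have span: "\<exists>\<alpha> \<beta> \<gamma>. v = \<alpha> *s q1 + \<beta> *s q2 + \<gamma> *s q3" for v
    by (rule basis[OF q q_nonzero])
  obtain a b c where p2_eq: "p2 = a *s q1 + b *s q2 + c *s q3" using span by blast
  have not_multiple: "R = R'"
    if "R \<in> proj_points" "R' \<in> proj_points" "r \<in> R" "r' \<in> R'" "r' \<noteq> 0" "r' = k *s r"
    for R R' r r' k
  proof (rule proj_points_eqI[OF that(1,2) _ that(4,5)])
    show "r' \<in> R" using that(1,3,6) by (simp add: proj_points_def vec.subspace_scale)
  qed
  have not_L: "k = 0" if "k *s r \<in> L" "r \<in> R" "r \<noteq> 0" "R \<in> {Q1, Q2, Q3}" for k r R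
  proof (rule ccontr)
    assume "k \<noteq> 0"
    then have "r \<in> L"
      using vec.subspace_scale[OF subspace[of L] that(1), of "inverse k"] by simp
    moreover have "R = vec.span {r}"
      using that(2-4) pt by (intro proj_point_eq_span) (elim insertE emptyE, simp_all)
    ultimately have "R \<subseteq> L"
      using subspace[of L] vec.span_minimal[of "{r}" L] by simp
    then show False using that(4) Q_not_L by (elim insertE emptyE) simp_all
  qed
  have p_in_L: "p1 \<in> L" "p2 \<in> L" using p1(1) p2(1) L(2,3) by blast+
  have in_L: "p2 - k *s p1 \<in> L" for k
    using p_in_L subspace[of L] by (simp add: vec.subspace_diff vec.subspace_scale)
  have diff: "p2 - k *s p1 = (a - k) *s q1 + (b - k) *s q2 + (c - k) *s q3" for k
    by (simp add: p2_eq p1_sum vec_eq_iff algebra_simps)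
  have p2_not: "p2 \<noteq> k *s p1" for k
    using not_multiple[OF pt(1,2) p1(1) p2] ne(1) by blast
  \<comment> \<open>If two coordinates of p2 agree, subtracting that multiple of p1 leaves a
    multiple of a single qi on L. As Qi is not on L this multiple is 0, so p2 is a multiple of p1,
    contradicting P1 \<noteq> P2.\<close>
  have "a \<noteq> b"
  proof
    assume "a = b"
    then have "c - a = 0" using in_L[of a] diff[of a] not_L[of "c - a" q3 Q3] q q_nonzero by simp
    then show False using diff[of a] p2_not[of a] \<open>a = b\<close> by simp
  qed
  moreover have "a \<noteq> c"
  proof
    assume "a = c"
    then have "b - a = 0" using in_L[of a] diff[of a] not_L[of "b - a" q2 Q2] q q_nonzero by simp
    then show False using diff[of a] p2_not[of a] \<open>a = c\<close> by simp
  qed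
  moreover have "b \<noteq> c"
  proof
    assume "b = c"
    then have "a - b = 0" using in_L[of b] diff[of b] not_L[of "a - b" q1 Q1] q q_nonzero by simp
    then show False using diff[of b] p2_not[of b] \<open>b = c\<close> by simp
  qed
  ultimately have abc: "distinct [a, b, c]" by simp
  have abc_nonzero: "a \<noteq> 0" "b \<noteq> 0" "c \<noteq> 0"
    using coords[OF _ q, of P2 a b c] p2 unfolding p2_eq by simp_all
  have "p2 \<notin> vec.span {p1}" using p2_not by (auto simp: vec.span_singleton)
  then have "vec.independent {p2, p1}" "card {p2, p1} = 2"
    using p1 by (auto simp: vec.independent_insert vec.span_base card_insert_if)
  then have L_span: "L \<subseteq> vec.span {p2, p1}"
    using vec.card_ge_dim_independent[of "{p2, p1}" L] L(1) p_in_L by (simp add: proj_lines_def)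
  \<comment> \<open>A point of L other than P1 is represented by t p1 - p2, with coordinates t - a,
    t - b, t - c. Here t = 0 would give P2, and t = a, b or c would put the point on the
    triangle.\<close>
  have parameter: "\<exists>t. t *s p1 - p2 \<in> P \<and> t \<notin> {0, a, b, c}"
    if P: "P \<in> {P3, P4}" and p: "p \<in> P" "p \<noteq> 0" for P p
  proof -
    have Ppt: "P \<in> proj_points" and Pne: "P1 \<noteq> P" "P2 \<noteq> P"
      using P pt ne by (elim insertE emptyE; simp)+
    have "p \<in> L" using P p(1) L by blast
    then have "p \<in> vec.span {p2, p1}" using L_span by blast
    then obtain y where "p - y *s p2 \<in> vec.span {p1}"
      using vec.span_breakdown_eq by blast
    then obtain x where "p - y *s p2 = x *s p1"
      by (auto simp: vec.span_singleton)
    then have x: "p = x *s p1 + y *s p2" by (simp add: algebra_simps)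
    have "y \<noteq> 0"
    proof
      assume "y = 0"
      then show False using Pne(1) not_multiple[OF pt(1) Ppt p1(1) p, of x] x by simp
    qed
    have "x \<noteq> 0"
    proof
      assume "x = 0"
      then show False using Pne(2) not_multiple[OF pt(2) Ppt p2(1) p, of y] x by simp
    qed
    define t where "t = - x / y"
    have t: "t *s p1 - p2 = (- 1 / y) *s p"
      using \<open>y \<noteq> 0\<close> by (simp add: t_def x vec_eq_iff field_simps)
    have tP: "t *s p1 - p2 \<in> P"
      unfolding t by (rule vec.subspace_scale) (use p(1) Ppt in \<open>simp_all add: proj_points_def\<close>)
    have "t *s p1 - p2 = (t - a) *s q1 + (t - b) *s q2 + (t - c) *s q3"
      by (simp add: p2_eq p1_sum vec_eq_iff algebra_simps)
    moreover have "t *s p1 - p2 \<noteq> 0" using t \<open>y \<noteq> 0\<close> p by simp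
    ultimately have "t - a \<noteq> 0 \<and> t - b \<noteq> 0 \<and> t - c \<noteq> 0"
      using coords[OF _ q, of P "t - a" "t - b" "t - c"] P tP by (simp add: insert_commute)
    moreover have "t \<noteq> 0" using \<open>x \<noteq> 0\<close> \<open>y \<noteq> 0\<close> by (simp add: t_def)
    ultimately show ?thesis using tP by (intro exI[of _ t]) simp
  qed
  obtain d where d: "d *s p1 - p2 \<in> P3" "d \<notin> {0, a, b, c}"
    using parameter[OF _ p3] by blast
  obtain e where e: "e *s p1 - p2 \<in> P4" "e \<notin> {0, a, b, c}"
    using parameter[OF _ p4] by blast
  have "d \<noteq> e"
  proof
    assume "d = e"
    moreover have "d *s p1 - p2 \<noteq> 0" using p2_not[of d] by simp
    ultimately have "P3 = P4"
      using proj_points_eqI[OF pt(3,4) d(1)] e(1) by simp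
    then show False using ne by simp
  qed
  have line_coords: "t *s p1 - p2 = (t - a) *s q1 + (t - b) *s q2 + (t - c) *s q3" for t
    by (simp add: p2_eq p1_sum vec_eq_iff algebra_simps)
  show ?thesis
  proof (rule waldschmidt_eqI)
    fix m D f
    assume f: "f \<in> symbolic_power Z m" "homogeneous_poly3 D f" "f \<noteq> 0"
    \<comment> \<open>Dropping points enlarges the symbolic power, so the bound for the seven points
      applies to Z.\<close>
    have f_Y: "f \<in> symbolic_power {P1, P2, P3, P4, Q1, Q2, Q3} m"
      using f(1) Z(1) by (auto simp: symbolic_power_def)
    show "10 * m \<le> 4 * D"
    proof (rule multiplicity_bound_generic[OF _ _ _ _ abc q _ _ _ _ span f_Y f(2,3)])
      show "distinct [0, d, e]" "a \<notin> {0, d, e}" "b \<notin> {0, d, e}" "c \<notin> {0, d, e}"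
        using d e abc_nonzero \<open>d \<noteq> e\<close> by auto
      show "q1 + q2 + q3 \<in> P1" using p1 by (simp add: p1_sum)
      show "a *s q1 + b *s q2 + c *s q3 \<in> P2" using p2 by (simp add: p2_eq)
      show "(d - a) *s q1 + (d - b) *s q2 + (d - c) *s q3 \<in> P3" using d by (simp add: line_coords)
      show "(e - a) *s q1 + (e - b) *s q2 + (e - c) *s q3 \<in> P4" using e by (simp add: line_coords)
    qed
  next
    fix m k :: nat assume m: "m \<le> 2 * k"
    \<comment> \<open>l is an equation of L, and l1, l2, l3 are equations of the sides opposite Q1,
      Q2, Q3.\<close>
    obtain l where l: "l \<noteq> 0" "homogeneous_poly3 1 l" "\<And>P. P \<subseteq> vec.span {p2, p1} \<Longrightarrow> l \<in> point_ideal P"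
      using vanishing_linear_form[of p2 p1] by blast
    obtain l1 where l1: "l1 \<noteq> 0" "homogeneous_poly3 1 l1" "\<And>P. P \<subseteq> vec.span {q2, q3} \<Longrightarrow> l1 \<in> point_ideal P"
      using vanishing_linear_form[of q2 q3] by blast
    obtain l2 where l2: "l2 \<noteq> 0" "homogeneous_poly3 1 l2" "\<And>P. P \<subseteq> vec.span {q1, q3} \<Longrightarrow> l2 \<in> point_ideal P"
      using vanishing_linear_form[of q1 q3] by blast
    obtain l3 where l3: "l3 \<noteq> 0" "homogeneous_poly3 1 l3" "\<And>P. P \<subseteq> vec.span {q1, q2} \<Longrightarrow> l3 \<in> point_ideal P"
      using vanishing_linear_form[of q1 q2] by blast
    note Q_span = proj_point_eq_span[OF pt(5) q(1) q_nonzero(1)]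
      proj_point_eq_span[OF pt(6) q(2) q_nonzero(2)] proj_point_eq_span[OF pt(7) q(3) q_nonzero(3)]
    have sub: "vec.span {r} \<subseteq> vec.span {r, r'}" "vec.span {r'} \<subseteq> vec.span {r, r'}" for r r' :: "'k^3"
      by (auto intro!: vec.span_mono)
    show "\<exists>f\<in>symbolic_power Z m. f \<noteq> 0 \<and> homogeneous_poly3 (m + 3 * k) f"
    proof (rule symbolic_power_element[OF l(1) l1(1) l2(1) l3(1) l(2) l1(2) l2(2) l3(2) _ _ _ _ _ _ _ m])
      show "l \<in> point_ideal P" if "P \<in> Z - {Q1, Q2, Q3}" for P
      proof (rule l(3))
        have "P \<subseteq> L"
        proof (cases "P \<in> {P1, P2, P3, P4}")
          case True
          then show ?thesis using L(2-5) by (elim insertE emptyE) simp_all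
        next
          case False
          then have "P \<in> Z - {P1, P2, P3, P4, Q1, Q2, Q3}" using that by simp
          then show ?thesis using Z(2) by (rule bspec[rotated])
        qed
        then show "P \<subseteq> vec.span {p2, p1}" using L_span by (rule subset_trans)
      qed
      show "l2 \<in> point_ideal Q1" "l3 \<in> point_ideal Q1" "l1 \<in> point_ideal Q2"
        "l3 \<in> point_ideal Q2" "l1 \<in> point_ideal Q3" "l2 \<in> point_ideal Q3"
        unfolding Q_span by (intro l1(3) l2(3) l3(3) sub)+
    qed
  qed
qed

theorem theorem2p5:
  fixes P1 P2 P3 P4 Q1 Q2 Q3 L :: "('k::{alg_closed_field, field_char_0}^3) set"
    and X Y :: "('k^3) set set"
    and n :: nat
  assumes Y_def: "Y = {P1, P2, P3, P4, Q1, Q2, Q3}"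
    and Y_points: "Y \<subseteq> proj_points"
    and Y_distinct: "distinct [P1, P2, P3, P4, Q1, Q2, Q3]"
    and L_line: "L \<in> proj_lines"
    and P_on_L: "P1 \<subseteq> L" "P2 \<subseteq> L" "P3 \<subseteq> L" "P4 \<subseteq> L"
    and Q_not_on_L: "\<not> Q1 \<subseteq> L" "\<not> Q2 \<subseteq> L" "\<not> Q3 \<subseteq> L"
    and Q_not_collinear: "\<not> proj_collinear {Q1, Q2, Q3}"
    and P_not_Q_collinear:
      "\<forall>P\<in>{P1, P2, P3, P4}. \<not> Q_collinear Q1 Q2 Q3 P"
    and n_gt: "n > 7"
    and X_points: "X \<subseteq> proj_points"
    and X_card: "finite X" "card X = n"
    and X_extends: "Y \<subseteq> X" "\<forall>P\<in>X - Y. P \<subseteq> L"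
  shows "waldschmidt X = waldschmidt Y \<and> waldschmidt Y = 5 / 2"
proof -
  have *: "waldschmidt Z = 5 / 2" if "Y \<subseteq> Z" "\<forall>P\<in>Z - Y. P \<subseteq> L" for Z
    using waldschmidt_points_on_line_and_triangle[OF _ Y_distinct L_line P_on_L Q_not_on_L
        Q_not_collinear P_not_Q_collinear, of Z] Y_points that
    unfolding Y_def by blast
  show ?thesis using *[OF X_extends] *[of Y] by simp
qed

end
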